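(* Let $H$ be a complex Hilbert space, let $A\in\mathcal{B}(H)$ and $B\in\mathcal{B}(\ell^2)$ be positive, and let $F=\{f_n\}_{n\in\mathbb{N}}\subset H$ be a sequence. Assume that the reduced weighted adjoints $C_{AB}^{\#}$, $D_{AB}^{\#}$ and $S_{AB}^{\#}$ exist. For a fixed $\alpha>0$, the following conditions are equivalent. (1) $F$ is an $AB$-lower semi-frame with lower bound $\alpha$. (2) One has $\mathcal{N}(P_BC_{AB})=\mathcal{D}(C_{AB})\cap\mathcal{N}(A)$, and the map $$\Phi_{AB}:\mathcal{R}(P_BC_{AB})\longrightarrow\frac{\mathcal{D}(C_{AB})}{\mathcal{D}(C_{AB})\cap\mathcal{N}(A)},\qquad\Phi_{AB}(P_BC_{AB}f)=[f],$$ is bounded from the $B$-seminorm to the $A$-seminorm and satisfies $\|\Phi_{AB}(P_BC_{AB}f)\|_A\le\alpha^{-1/2}\|P_BC_{AB}f\|_B$ for all $f\in\mathcal{D}(C_{AB})$. (3) Let $\mathcal{G}_{AB}=\mathcal{D}(C_{AB})/(\mathcal{D}(C_{AB})\cap\mathcal{N}(A))$ with graph seminorm $\|[f]\|_{\mathcal{G}_{AB}}^2=\|f\|_A^2+\|P_BC_{AB}f\|_B^2$. Then the map $\widehat{C}_{AB}:\mathcal{G}_{AB}\to\mathcal{R}(P_BC_{AB})$, $\widehat{C}_{AB}[f]=P_BC_{AB}f$, is a topological isomorphism onto its range and $$\|\widehat{C}_{AB}^{-1}(P_BC_{AB}f)\|_{\mathcal{G}_{AB}}^2\le(1+\alpha^{-1})\|P_BC_{AB}f\|_B^2$$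 for every $f\in\mathcal{D}(C_{AB})$.
   Context: $\ell^2=\ell^2(\mathbb{N})$ is the complex Hilbert space of square-summable sequences; inner products are linear in the first variable; $\langle f,g\rangle_A=\langle Af,g\rangle$, $\|f\|_A=\langle Af,f\rangle^{1/2}$ on $H$ and $\|c\|_B=\langle Bc,c\rangle^{1/2}$ on $\ell^2$. $\mathcal{D}$, $\mathcal{R}$, $\mathcal{N}$ denote domain, range and null space, $T^*$ the Hilbert-space adjoint; $P_B$ is the orthogonal projection onto $\overline{\mathcal{R}(B)}$. $[f]$ is the class of $f$ in the quotient $\mathcal{D}(C_{AB})/(\mathcal{D}(C_{AB})\cap\mathcal{N}(A))$, with $A$-seminorm $\|[f]\|_A=\|f\|_A$; $\mathcal{R}(P_BC_{AB})$ carries the $B$-seminorm. Operators associated with $F$: $D_Fc=\sum_{n=1}^\infty c_nf_n$ with $\mathcal{D}(D_F)=\{c\in\ell^2:\sum_{n=1}^\infty c_nf_n\text{ converges in }H\}$; $C_{AB}f=\{\langle f,f_n\rangle_A\}_n$ with $\mathcal{D}(C_{AB})=\{f\in H:\{\langle f,f_n\rangle_A\}_n\in\ell^2\}$; $D_{AB}=D_FB$ with $\mathcal{D}(D_{AB})=\{c\in\ell^2:Bc\in\mathcal{D}(D_F)\}$; $S_{AB}=D_{AB}C_{AB}$ with $\mathcal{D}(S_{AB})=\{f\in\mathcal{D}(C_{AB}):C_{AB}f\in\mathcal{D}(D_{AB})\}$. $F$ is an $AB$-lower semi-frame with lower bound $\alpha>0$ if $\alpha\|f\|_A^2\le\|C_{AB}f\|_B^2$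 for all $f\in\mathcal{D}(C_{AB})$. Reduced weighted adjoints. For densely defined $T:\mathcal{D}(T)\subseteq H\to\ell^2$, $T^{\#}$ is the unique operator from $\ell^2$ to $H$ with $AT^{\#}=T^*B$ and $\mathcal{R}(T^{\#})\subseteq\overline{\mathcal{R}(A)}$; it exists when $\mathcal{R}(T^*B)\subseteq\mathcal{R}(A)$. For densely defined $R:\mathcal{D}(R)\subseteq\ell^2\to H$, $R^{\#}$ is the unique operator from $H$ to $\ell^2$ with $BR^{\#}=R^*A$ and $\mathcal{R}(R^{\#})\subseteq\overline{\mathcal{R}(B)}$; it exists when $\mathcal{R}(R^*A)\subseteq\mathcal{R}(B)$. For a densely defined closable $S:\mathcal{D}(S)\subseteq H\to H$, the $A$-adjoint $S^{\#}$ is the unique operator on $H$ with $AS^{\#}=S^*A$ and $\mathcal{R}(S^{\#})\subseteq\overline{\mathcal{R}(A)}$; it exists when $\mathcal{R}(S^*A)\subseteq\mathcal{R}(A)$. All these operator equalities include equality of domains. *)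

theory Defs
  imports "HOL-Analysis.Analysis" "HOL-Library.Set_Algebras"
begin

section \<open>Complex Hilbert spaces\<close>

text \<open>A complex inner product space is a real inner product space with a compatible complex
  structure; the complex inner product is linear in its first argument, and the norm and the
  topology are those of the real inner product \<open>Re \<langle>x, y\<rangle>\<close>.\<close>

class complex_inner = real_inner +
  fixes scaleC :: "complex \<Rightarrow> 'a \<Rightarrow> 'a" (infixr "*\<^sub>C" 75)
    and cinner :: "'a \<Rightarrow> 'a \<Rightarrow> complex"
  assumes scaleC_add_right: "a *\<^sub>C (x + y) = a *\<^sub>C x + a *\<^sub>C y"
    and scaleC_add_left: "(a + b) *\<^sub>C x = a *\<^sub>C x + b *\<^sub>C x"
    and scaleC_scaleC: "a *\<^sub>C b *\<^sub>C x = (a * b) *\<^sub>C x"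
    and scaleR_scaleC: "r *\<^sub>R x = complex_of_real r *\<^sub>C x"
    and cinner_commute: "cinner x y = cnj (cinner y x)"
    and cinner_add_left: "cinner (x + y) z = cinner x z + cinner y z"
    and cinner_scaleC_left: "cinner (a *\<^sub>C x) y = a * cinner x y"
    and inner_eq_Re_cinner: "inner x y = Re (cinner x y)"

class complex_hilbert = complex_inner + complete_space

definition csubspace :: "'a::complex_inner set \<Rightarrow> bool" where
  "csubspace M \<longleftrightarrow> 0 \<in> M \<and> (\<forall>x\<in>M. \<forall>y\<in>M. x + y \<in> M) \<and> (\<forall>a. \<forall>x\<in>M. a *\<^sub>C x \<in> M)"

section \<open>The Hilbert space of square-summable sequences\<close>

typedef ell2 = "{c :: nat \<Rightarrow> complex. summable (\<lambda>n. (cmod (c n))\<^sup>2)}"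
  morphisms ell2_nth Abs_ell2
  by (rule exI[of _ "\<lambda>_. 0"]) simp

lemma ell2_summable_sq: "summable (\<lambda>n. (cmod (ell2_nth c n))\<^sup>2)"
  using ell2_nth[of c] by simp

lemma ell2_eqI: "(\<And>n. ell2_nth c n = ell2_nth d n) \<Longrightarrow> c = d"
  using ell2_nth_inject by blast

lemma ell2_nth_Abs: "summable (\<lambda>n. (cmod (c n))\<^sup>2) \<Longrightarrow> ell2_nth (Abs_ell2 c) = c"
  by (simp add: Abs_ell2_inverse)

lemma ell2_summable_norm_mult:
  "summable (\<lambda>n. cmod (ell2_nth c n * cnj (ell2_nth d n)))"
proof (rule summable_comparison_test')
  show "summable (\<lambda>n. (cmod (ell2_nth c n))\<^sup>2 + (cmod (ell2_nth d n))\<^sup>2)"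
    by (intro summable_add ell2_summable_sq)
  show "norm (cmod (ell2_nth c n * cnj (ell2_nth d n)))
      \<le> (cmod (ell2_nth c n))\<^sup>2 + (cmod (ell2_nth d n))\<^sup>2" for n
  proof -
    let ?a = "cmod (ell2_nth c n)" and ?b = "cmod (ell2_nth d n)"
    have "2 * ?a * ?b \<le> ?a\<^sup>2 + ?b\<^sup>2" by (rule sum_squares_bound)
    moreover have "0 \<le> ?a * ?b" by simp
    ultimately have "?a * ?b \<le> ?a\<^sup>2 + ?b\<^sup>2" by linarith
    then show ?thesis by (simp add: norm_mult)
  qed
qed

lemma ell2_summable_mult: "summable (\<lambda>n. ell2_nth c n * cnj (ell2_nth d n))"
  using ell2_summable_norm_mult by (rule summable_norm_cancel)

lemma ell2_summable_add: "summable (\<lambda>n. (cmod (ell2_nth c n + ell2_nth d n))\<^sup>2)"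
proof (rule summable_comparison_test')
  show "summable (\<lambda>n. 2 * (cmod (ell2_nth c n))\<^sup>2 + 2 * (cmod (ell2_nth d n))\<^sup>2)"
    by (intro summable_add summable_mult ell2_summable_sq)
  show "norm ((cmod (ell2_nth c n + ell2_nth d n))\<^sup>2)
      \<le> 2 * (cmod (ell2_nth c n))\<^sup>2 + 2 * (cmod (ell2_nth d n))\<^sup>2" for n
  proof -
    let ?a = "cmod (ell2_nth c n)" and ?b = "cmod (ell2_nth d n)"
    have "(cmod (ell2_nth c n + ell2_nth d n))\<^sup>2 \<le> (?a + ?b)\<^sup>2"
      by (intro power_mono norm_triangle_ineq) simp
    also have "\<dots> \<le> 2 * ?a\<^sup>2 + 2 * ?b\<^sup>2"
      using sum_squares_bound[of ?a ?b] by (simp add: power2_sum)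
    finally show ?thesis by simp
  qed
qed

lemma ell2_summable_scale: "summable (\<lambda>n. (cmod (a * ell2_nth c n))\<^sup>2)"
  by (simp add: norm_mult power_mult_distrib summable_mult ell2_summable_sq)

instantiation ell2 :: complex_inner
begin

definition zero_ell2 where "(0 :: ell2) = Abs_ell2 (\<lambda>_. 0)"
definition plus_ell2 where "c + d = Abs_ell2 (\<lambda>n. ell2_nth c n + ell2_nth d n)"
definition scaleC_ell2 where "a *\<^sub>C c = Abs_ell2 (\<lambda>n. a * ell2_nth c n)"
definition uminus_ell2 where "- (c :: ell2) = (-1) *\<^sub>C c"
definition minus_ell2 where "c - (d :: ell2) = c + - d"
definition scaleR_ell2 where "r *\<^sub>R (c :: ell2) = complex_of_real r *\<^sub>C c"
definition cinner_ell2 where "cinner c d = (\<Sum>n. ell2_nth c n * cnj (ell2_nth d n))"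
definition inner_ell2 where "inner c (d :: ell2) = Re (cinner c d)"
definition norm_ell2 where "norm (c :: ell2) = sqrt (inner c c)"
definition sgn_ell2 where "sgn (c :: ell2) = inverse (norm c) *\<^sub>R c"
definition dist_ell2 where "dist c (d :: ell2) = norm (c - d)"
definition uniformity_ell2 where
  "(uniformity :: (ell2 \<times> ell2) filter) = (INF e\<in>{0<..}. principal {(x, y). dist x y < e})"
definition open_ell2 where
  "open (U :: ell2 set) \<longleftrightarrow> (\<forall>x\<in>U. eventually (\<lambda>(x', y). x' = x \<longrightarrow> y \<in> U) uniformity)"

lemma nth_zero [simp]: "ell2_nth 0 n = 0"
  by (simp add: zero_ell2_def ell2_nth_Abs)

lemma nth_add [simp]: "ell2_nth (c + d) n = ell2_nth c n + ell2_nth d n"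
  by (simp add: plus_ell2_def ell2_nth_Abs ell2_summable_add)

lemma nth_scaleC [simp]: "ell2_nth (a *\<^sub>C c) n = a * ell2_nth c n"
  by (simp add: scaleC_ell2_def ell2_nth_Abs ell2_summable_scale)

lemma nth_uminus [simp]: "ell2_nth (- c) n = - ell2_nth c n"
  by (simp add: uminus_ell2_def)

lemma nth_minus [simp]: "ell2_nth (c - d) n = ell2_nth c n - ell2_nth d n"
  by (simp add: minus_ell2_def)

lemma nth_scaleR [simp]: "ell2_nth (r *\<^sub>R c) n = complex_of_real r * ell2_nth c n"
  by (simp add: scaleR_ell2_def)

lemma inner_self_ell2: "inner c (c :: ell2) = (\<Sum>n. (cmod (ell2_nth c n))\<^sup>2)"
proof -
  have "(\<lambda>n. ell2_nth c n * cnj (ell2_nth c n)) sums cinner c c"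
    unfolding cinner_ell2_def by (intro summable_sums ell2_summable_mult)
  from sums_Re[OF this] show ?thesis
    by (simp add: inner_ell2_def sums_iff complex_mult_cnj cmod_power2
        flip: power2_eq_square)
qed

instance
proof
  fix x y z :: ell2 and a b :: complex and r s :: real
  show "x + y + z = x + (y + z)" "x + y = y + x" "0 + x = x" "- x + x = 0" "x - y = x + - y"
    by (rule ell2_eqI; simp add: algebra_simps)+
  show "r *\<^sub>R (x + y) = r *\<^sub>R x + r *\<^sub>R y" "(r + s) *\<^sub>R x = r *\<^sub>R x + s *\<^sub>R x"
    "r *\<^sub>R s *\<^sub>R x = (r * s) *\<^sub>R x" "1 *\<^sub>R x = x"
    by (rule ell2_eqI; simp add: algebra_simps)+
  show "a *\<^sub>C (x + y) = a *\<^sub>C x + a *\<^sub>C y" "(a + b) *\<^sub>C x = a *\<^sub>C x + b *\<^sub>C x"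
    "a *\<^sub>C b *\<^sub>C x = (a * b) *\<^sub>C x"
    by (rule ell2_eqI; simp add: algebra_simps)+
  show "r *\<^sub>R x = complex_of_real r *\<^sub>C x" by (rule scaleR_ell2_def)
  show comm: "cinner x y = cnj (cinner y x)" for x y :: ell2
  proof -
    have "(\<lambda>n. ell2_nth y n * cnj (ell2_nth x n)) sums cinner y x"
      unfolding cinner_ell2_def by (intro summable_sums ell2_summable_mult)
    from sums_cnj[THEN iffD2, OF this] show ?thesis
      by (simp add: cinner_ell2_def sums_iff mult.commute)
  qed
  show add: "cinner (x + y) z = cinner x z + cinner y z" for x y z :: ell2
    by (simp add: cinner_ell2_def ring_distribs ell2_summable_mult suminf_add)
  show scale: "cinner (a *\<^sub>C x) y = a * cinner x y" for a and x y :: ell2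
    by (simp add: cinner_ell2_def mult.assoc ell2_summable_mult suminf_mult)
  show "inner x y = Re (cinner x y)" by (rule inner_ell2_def)
  show "inner x y = inner y x" using comm[of x y] by (simp add: inner_ell2_def)
  show "inner (x + y) z = inner x z + inner y z" by (simp add: inner_ell2_def add)
  show "inner (r *\<^sub>R x) y = r * inner x y" by (simp add: inner_ell2_def scaleR_ell2_def scale)
  show "0 \<le> inner x x"
    unfolding inner_self_ell2 by (intro suminf_nonneg ell2_summable_sq) simp
  show "(inner x x = 0) = (x = 0)"
  proof
    assume "inner x x = 0"
    then have "\<forall>n. (cmod (ell2_nth x n))\<^sup>2 = 0"
      unfolding inner_self_ell2
      by (subst (asm) suminf_eq_zero_iff) (auto intro: ell2_summable_sq)
    then show "x = 0" by (intro ell2_eqI) simp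
  qed (simp add: inner_self_ell2)
  show "norm x = sqrt (inner x x)" by (rule norm_ell2_def)
  show "sgn x = inverse (norm x) *\<^sub>R x" by (rule sgn_ell2_def)
  show "dist x y = norm (x - y)" by (rule dist_ell2_def)
  show "(uniformity :: (ell2 \<times> ell2) filter) = (INF e\<in>{0<..}. principal {(x, y). dist x y < e})"
    by (rule uniformity_ell2_def)
  show "open U \<longleftrightarrow> (\<forall>x\<in>U. eventually (\<lambda>(x', y). x' = x \<longrightarrow> y \<in> U) uniformity)" for U :: "ell2 set"
    by (rule open_ell2_def)
qed

end

lemma norm_ell2_power2: "(norm (c :: ell2))\<^sup>2 = (\<Sum>n. (cmod (ell2_nth c n))\<^sup>2)"
  by (simp add: power2_norm_eq_inner inner_self_ell2)

lemma ell2_partial_sum_le: "(\<Sum>k<K. (cmod (ell2_nth c k))\<^sup>2) \<le> (norm c)\<^sup>2"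
  unfolding norm_ell2_power2 by (intro sum_le_suminf ell2_summable_sq) auto

lemma ell2_nth_le_norm: "cmod (ell2_nth c k) \<le> norm c"
proof -
  have "(cmod (ell2_nth c k))\<^sup>2 \<le> (\<Sum>k<Suc k. (cmod (ell2_nth c k))\<^sup>2)"
    by (simp add: sum_nonneg)
  also have "\<dots> \<le> (norm c)\<^sup>2" by (rule ell2_partial_sum_le)
  finally show ?thesis by (rule power2_le_imp_le) simp
qed

instance ell2 :: complex_hilbert
proof
  fix X :: "nat \<Rightarrow> ell2"
  assume X: "Cauchy X"
  have "Cauchy (\<lambda>n. ell2_nth (X n) k)" for k
  proof (rule CauchyI)
    fix e :: real assume "0 < e"
    from CauchyD[OF X this] obtain M where
      M: "\<And>m n. m \<ge> M \<Longrightarrow> n \<ge> M \<Longrightarrow> norm (X m - X n) < e" by blast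
    have "cmod (ell2_nth (X m) k - ell2_nth (X n) k) < e" if "m \<ge> M" "n \<ge> M" for m n
      using ell2_nth_le_norm[of "X m - X n" k] M[OF that] by simp
    then show "\<exists>M. \<forall>m\<ge>M. \<forall>n\<ge>M. norm (ell2_nth (X m) k - ell2_nth (X n) k) < e" by blast
  qed
  then have "\<forall>k. \<exists>l. (\<lambda>n. ell2_nth (X n) k) \<longlonglongrightarrow> l"
    using Cauchy_convergent convergent_def by blast
  then obtain l where l: "\<And>k. (\<lambda>n. ell2_nth (X n) k) \<longlonglongrightarrow> l k" by metis
  have tail: "\<exists>M. \<forall>m\<ge>M. \<forall>K. (\<Sum>k<K. (cmod (ell2_nth (X m) k - l k))\<^sup>2) \<le> e\<^sup>2"
    if "0 < e" for e :: real
  proof -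
    from CauchyD[OF X that] obtain M where
      M: "\<And>m n. m \<ge> M \<Longrightarrow> n \<ge> M \<Longrightarrow> norm (X m - X n) < e" by blast
    have "(\<Sum>k<K. (cmod (ell2_nth (X m) k - l k))\<^sup>2) \<le> e\<^sup>2" if m: "m \<ge> M" for m K
    proof (rule LIMSEQ_le_const2)
      show "(\<lambda>n. \<Sum>k<K. (cmod (ell2_nth (X m) k - ell2_nth (X n) k))\<^sup>2)
          \<longlonglongrightarrow> (\<Sum>k<K. (cmod (ell2_nth (X m) k - l k))\<^sup>2)"
        by (intro tendsto_intros l)
      have "(\<Sum>k<K. (cmod (ell2_nth (X m) k - ell2_nth (X n) k))\<^sup>2) \<le> e\<^sup>2" if "n \<ge> M" for n
      proof -
        have "(\<Sum>k<K. (cmod (ell2_nth (X m) k - ell2_nth (X n) k))\<^sup>2) \<le> (norm (X m - X n))\<^sup>2"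
          using ell2_partial_sum_le[of "X m - X n" K] by simp
        also have "\<dots> \<le> e\<^sup>2" using M[OF m that] by (intro power_mono) auto
        finally show ?thesis .
      qed
      then show "\<exists>N. \<forall>n\<ge>N. (\<Sum>k<K. (cmod (ell2_nth (X m) k - ell2_nth (X n) k))\<^sup>2) \<le> e\<^sup>2"
        by blast
    qed
    then show ?thesis by blast
  qed
  obtain M where M: "\<And>K. (\<Sum>k<K. (cmod (ell2_nth (X M) k - l k))\<^sup>2) \<le> 1\<^sup>2"
    using tail[of 1] by auto
  have "summable (\<lambda>k. (cmod (ell2_nth (X M) k - l k))\<^sup>2)"
    by (rule summableI_nonneg_bounded[where x = "1\<^sup>2"]) (use M in auto)
  then have d: "ell2_nth (Abs_ell2 (\<lambda>k. ell2_nth (X M) k - l k)) = (\<lambda>k. ell2_nth (X M) k - l k)"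
    by (rule ell2_nth_Abs)
  define L where "L = X M - Abs_ell2 (\<lambda>k. ell2_nth (X M) k - l k)"
  have L: "ell2_nth L k = l k" for k by (simp add: L_def d)
  have "X \<longlonglongrightarrow> L"
  proof (rule LIMSEQ_I)
    fix r :: real assume "0 < r"
    then obtain M where M: "\<And>m K. m \<ge> M \<Longrightarrow>
        (\<Sum>k<K. (cmod (ell2_nth (X m) k - l k))\<^sup>2) \<le> (r / 2)\<^sup>2"
      using tail[of "r / 2"] by auto
    have "norm (X m - L) < r" if "m \<ge> M" for m
    proof -
      have "(norm (X m - L))\<^sup>2 \<le> (r / 2)\<^sup>2"
        unfolding norm_ell2_power2
        by (rule suminf_le_const[OF ell2_summable_sq]) (use M[OF that] in \<open>simp add: L\<close>)
      then have "norm (X m - L) \<le> r / 2" by (rule power2_le_imp_le) (use \<open>0 < r\<close> in simp)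
      then show ?thesis using \<open>0 < r\<close> by simp
    qed
    then show "\<exists>no. \<forall>n\<ge>no. norm (X n - L) < r" by blast
  qed
  then show "convergent X" by (rule convergentI)
qed

section \<open>Bounded positive operators, weighted forms, orthogonal projections\<close>

definition bounded_clinear :: "('a::complex_inner \<Rightarrow> 'b::complex_inner) \<Rightarrow> bool" where
  "bounded_clinear T \<longleftrightarrow> bounded_linear T \<and> (\<forall>a x. T (a *\<^sub>C x) = a *\<^sub>C T x)"

definition positive_op :: "('a::complex_inner \<Rightarrow> 'a) \<Rightarrow> bool" where
  "positive_op A \<longleftrightarrow> bounded_clinear A \<and> (\<forall>f. cinner (A f) f \<in> \<real>\<^sub>\<ge>\<^sub>0)"

definition wcinner :: "('a::complex_inner \<Rightarrow> 'a) \<Rightarrow> 'a \<Rightarrow> 'a \<Rightarrow> complex" where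
  "wcinner A f g = cinner (A f) g"

definition wseminorm :: "('a::complex_inner \<Rightarrow> 'a) \<Rightarrow> 'a \<Rightarrow> real" where
  "wseminorm A f = sqrt (Re (cinner (A f) f))"

definition null_space :: "('a \<Rightarrow> 'b::zero) \<Rightarrow> 'a set" where
  "null_space A = {f. A f = 0}"

definition orth_proj :: "'a::complex_inner set \<Rightarrow> 'a \<Rightarrow> 'a" where
  "orth_proj M x = (THE p. p \<in> M \<and> (\<forall>m\<in>M. cinner (x - p) m = 0))"

definition range_proj :: "('a::complex_inner \<Rightarrow> 'a) \<Rightarrow> 'a \<Rightarrow> 'a" where
  "range_proj B = orth_proj (closure (range B))"

section \<open>Unbounded operators\<close>

text \<open>Not everywhere defined operators are partial maps; equality of partial maps includes
  equality of domains, and \<open>R \<circ>\<^sub>m T\<close> has the natural domain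
  \<open>{x \<in> dom T. T x \<in> dom R}\<close>.\<close>

definition total_op :: "('a \<Rightarrow> 'b) \<Rightarrow> 'a \<rightharpoonup> 'b" where
  "total_op A = (\<lambda>x. Some (A x))"

definition linear_op :: "('a::complex_inner \<rightharpoonup> 'b::complex_inner) \<Rightarrow> bool" where
  "linear_op T \<longleftrightarrow> csubspace (dom T)
     \<and> (\<forall>x\<in>dom T. \<forall>y\<in>dom T. the (T (x + y)) = the (T x) + the (T y))
     \<and> (\<forall>a. \<forall>x\<in>dom T. the (T (a *\<^sub>C x)) = a *\<^sub>C the (T x))"

definition null_space_op :: "('a \<rightharpoonup> 'b::zero) \<Rightarrow> 'a set" where
  "null_space_op T = {x \<in> dom T. T x = Some 0}"

definition densely_defined :: "('a::topological_space \<rightharpoonup> 'b) \<Rightarrow> bool" where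
  "densely_defined T \<longleftrightarrow> closure (dom T) = UNIV"

text \<open>The closure of the graph is again the graph of an operator.\<close>

definition closable :: "('a::topological_space \<rightharpoonup> 'b::topological_space) \<Rightarrow> bool" where
  "closable T \<longleftrightarrow> single_valued (closure (Map.graph T))"

text \<open>For densely defined \<open>T\<close> the vector \<open>z\<close> below is unique.\<close>

definition adjoint_op :: "('a::complex_inner \<rightharpoonup> 'b::complex_inner) \<Rightarrow> 'b \<rightharpoonup> 'a" where
  "adjoint_op T = (\<lambda>y.
     if \<exists>z. \<forall>x\<in>dom T. cinner (the (T x)) y = cinner x z
     then Some (THE z. \<forall>x\<in>dom T. cinner (the (T x)) y = cinner x z)
     else None)"

definition is_reduced_adjoint ::
  "('a::complex_inner \<Rightarrow> 'a) \<Rightarrow> ('b::complex_inner \<Rightarrow> 'b) \<Rightarrow> ('a \<rightharpoonup> 'b) \<Rightarrow> ('b \<rightharpoonup> 'a) \<Rightarrow> bool" where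
  "is_reduced_adjoint A B T U \<longleftrightarrow> linear_op U
     \<and> total_op A \<circ>\<^sub>m U = adjoint_op T \<circ>\<^sub>m total_op B
     \<and> ran U \<subseteq> closure (range A)"

text \<open>Here \<open>A\<close> is the weight on the space where \<open>T\<close> is defined and \<open>B\<close> the weight on its target
  space. Uniqueness of the reduced adjoint is automatic for positive \<open>A\<close>.\<close>

definition reduced_adjoint_exists ::
  "('a::complex_inner \<Rightarrow> 'a) \<Rightarrow> ('b::complex_inner \<Rightarrow> 'b) \<Rightarrow> ('a \<rightharpoonup> 'b) \<Rightarrow> bool" where
  "reduced_adjoint_exists A B T \<longleftrightarrow>
     densely_defined T \<and> (\<exists>U. is_reduced_adjoint A B T U)"

definition A_adjoint_exists ::
  "('a::complex_inner \<Rightarrow> 'a) \<Rightarrow> ('a \<rightharpoonup> 'a) \<Rightarrow> bool" where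
  "A_adjoint_exists A S \<longleftrightarrow> closable S \<and> reduced_adjoint_exists A A S"

section \<open>Operators associated with a sequence\<close>

definition D_op :: "(nat \<Rightarrow> 'h::complex_hilbert) \<Rightarrow> ell2 \<rightharpoonup> 'h" where
  "D_op F = (\<lambda>c. if summable (\<lambda>n. ell2_nth c n *\<^sub>C F n)
                 then Some (\<Sum>n. ell2_nth c n *\<^sub>C F n) else None)"

definition C_AB :: "('h::complex_hilbert \<Rightarrow> 'h) \<Rightarrow> (nat \<Rightarrow> 'h) \<Rightarrow> 'h \<rightharpoonup> ell2" where
  "C_AB A F = (\<lambda>f. if summable (\<lambda>n. (cmod (wcinner A f (F n)))\<^sup>2)
                   then Some (Abs_ell2 (\<lambda>n. wcinner A f (F n))) else None)"

definition D_AB :: "(ell2 \<Rightarrow> ell2) \<Rightarrow> (nat \<Rightarrow> 'h::complex_hilbert) \<Rightarrow> ell2 \<rightharpoonup> 'h" where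
  "D_AB B F = D_op F \<circ>\<^sub>m total_op B"

definition S_AB ::
  "('h::complex_hilbert \<Rightarrow> 'h) \<Rightarrow> (ell2 \<Rightarrow> ell2) \<Rightarrow> (nat \<Rightarrow> 'h) \<Rightarrow> 'h \<rightharpoonup> 'h" where
  "S_AB A B F = D_AB B F \<circ>\<^sub>m C_AB A F"

definition PC_AB ::
  "('h::complex_hilbert \<Rightarrow> 'h) \<Rightarrow> (ell2 \<Rightarrow> ell2) \<Rightarrow> (nat \<Rightarrow> 'h) \<Rightarrow> 'h \<rightharpoonup> ell2" where
  "PC_AB A B F = total_op (range_proj B) \<circ>\<^sub>m C_AB A F"

definition lower_semi_frame ::
  "('h::complex_hilbert \<Rightarrow> 'h) \<Rightarrow> (ell2 \<Rightarrow> ell2) \<Rightarrow> (nat \<Rightarrow> 'h) \<Rightarrow> real \<Rightarrow> bool" where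
  "lower_semi_frame A B F \<alpha> \<longleftrightarrow> 0 < \<alpha> \<and>
     (\<forall>f\<in>dom (C_AB A F). \<alpha> * (wseminorm A f)\<^sup>2 \<le> (wseminorm B (the (C_AB A F f)))\<^sup>2)"

section \<open>Seminormed spaces and their quotients\<close>

record 'v seminormed_space =
  carrier :: "'v set"
  vadd :: "'v \<Rightarrow> 'v \<Rightarrow> 'v"
  vscale :: "complex \<Rightarrow> 'v \<Rightarrow> 'v"
  seminorm :: "'v \<Rightarrow> real"

definition vdist :: "'v seminormed_space \<Rightarrow> 'v \<Rightarrow> 'v \<Rightarrow> real" where
  "vdist X x y = seminorm X (vadd X x (vscale X (-1) y))"

definition seminorm_topology :: "'v seminormed_space \<Rightarrow> 'v topology" where
  "seminorm_topology X = topology (\<lambda>U. U \<subseteq> carrier X \<and>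
     (\<forall>x\<in>U. \<exists>e>0. \<forall>y\<in>carrier X. vdist X y x < e \<longrightarrow> y \<in> U))"

lemma openin_seminorm_topology:
  "openin (seminorm_topology X) U \<longleftrightarrow> U \<subseteq> carrier X \<and>
     (\<forall>x\<in>U. \<exists>e>0. \<forall>y\<in>carrier X. vdist X y x < e \<longrightarrow> y \<in> U)"
proof -
  have "istopology (\<lambda>U. U \<subseteq> carrier X \<and>
     (\<forall>x\<in>U. \<exists>e>0. \<forall>y\<in>carrier X. vdist X y x < e \<longrightarrow> y \<in> U))" (is "istopology ?P")
    unfolding istopology_def
  proof (rule conjI; intro allI impI)
    fix S T assume S: "?P S" and T: "?P T"
    have "\<exists>e>0. \<forall>y\<in>carrier X. vdist X y x < e \<longrightarrow> y \<in> S \<inter> T" if x: "x \<in> S \<inter> T" for x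
    proof -
      obtain d e where "d > 0" "\<forall>y\<in>carrier X. vdist X y x < d \<longrightarrow> y \<in> S"
        and "e > 0" "\<forall>y\<in>carrier X. vdist X y x < e \<longrightarrow> y \<in> T"
        using S T x by blast
      then show ?thesis by (intro exI[of _ "min d e"]) auto
    qed
    then show "?P (S \<inter> T)" using S by blast
  next
    fix K assume "\<forall>S\<in>K. ?P S"
    then show "?P (\<Union>K)" by (meson Sup_le_iff Union_iff)
  qed
  then show ?thesis by (simp add: seminorm_topology_def topology_inverse')
qed

definition linear_between ::
  "'v seminormed_space \<Rightarrow> 'w seminormed_space \<Rightarrow> ('v \<Rightarrow> 'w) \<Rightarrow> bool" where
  "linear_between X Y T \<longleftrightarrow> T ` carrier X \<subseteq> carrier Y
     \<and> (\<forall>x\<in>carrier X. \<forall>y\<in>carrier X. T (vadd X x y) = vadd Y (T x) (T y))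
     \<and> (\<forall>a. \<forall>x\<in>carrier X. T (vscale X a x) = vscale Y a (T x))"

definition bounded_between ::
  "'v seminormed_space \<Rightarrow> 'w seminormed_space \<Rightarrow> ('v \<Rightarrow> 'w) \<Rightarrow> bool" where
  "bounded_between X Y T \<longleftrightarrow> linear_between X Y T
     \<and> (\<exists>K. \<forall>x\<in>carrier X. seminorm Y (T x) \<le> K * seminorm X x)"

definition top_iso_onto_range ::
  "'v seminormed_space \<Rightarrow> 'w seminormed_space \<Rightarrow> ('v \<Rightarrow> 'w) \<Rightarrow> bool" where
  "top_iso_onto_range X Y T \<longleftrightarrow> linear_between X Y T
     \<and> homeomorphic_map (seminorm_topology X)
         (subtopology (seminorm_topology Y) (T ` carrier X)) T"

definition subspace_seminormed ::
  "'v::complex_inner set \<Rightarrow> ('v \<Rightarrow> real) \<Rightarrow> 'v seminormed_space" where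
  "subspace_seminormed M p = \<lparr>carrier = M, vadd = (+), vscale = (*\<^sub>C), seminorm = p\<rparr>"

text \<open>The quotient \<open>M / N\<close>, with cosets \<open>f +o N = {f + n | n \<in> N}\<close> as elements. The seminorm of a
  coset is the common value of \<open>p\<close> on its members, so \<open>p\<close> has to be constant on cosets.
  In \<open>vscale\<close>, the summand \<open>N\<close> is needed for the scalar 0.\<close>

definition quotient_seminormed ::
  "'v::complex_inner set \<Rightarrow> 'v set \<Rightarrow> ('v \<Rightarrow> real) \<Rightarrow> 'v set seminormed_space" where
  "quotient_seminormed M N p =
     \<lparr>carrier = (\<lambda>f. f +o N) ` M,
      vadd = (\<lambda>X Y. X + Y),
      vscale = (\<lambda>a X. (*\<^sub>C) a ` X + N),
      seminorm = (\<lambda>X. the_elem (p ` X))\<rparr>"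

section \<open>The quotient of the domain of the analysis operator, and the induced maps\<close>

definition N_AB :: "('h::complex_hilbert \<Rightarrow> 'h) \<Rightarrow> (nat \<Rightarrow> 'h) \<Rightarrow> 'h set" where
  "N_AB A F = dom (C_AB A F) \<inter> null_space A"

definition cls_AB :: "('h::complex_hilbert \<Rightarrow> 'h) \<Rightarrow> (nat \<Rightarrow> 'h) \<Rightarrow> 'h \<Rightarrow> 'h set" where
  "cls_AB A F f = f +o N_AB A F"

definition Q_AB ::
  "('h::complex_hilbert \<Rightarrow> 'h) \<Rightarrow> (nat \<Rightarrow> 'h) \<Rightarrow> 'h set seminormed_space" where
  "Q_AB A F = quotient_seminormed (dom (C_AB A F)) (N_AB A F) (wseminorm A)"

definition G_AB ::
  "('h::complex_hilbert \<Rightarrow> 'h) \<Rightarrow> (ell2 \<Rightarrow> ell2) \<Rightarrow> (nat \<Rightarrow> 'h) \<Rightarrow> 'h set seminormed_space" where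
  "G_AB A B F = quotient_seminormed (dom (C_AB A F)) (N_AB A F)
     (\<lambda>f. sqrt ((wseminorm A f)\<^sup>2 + (wseminorm B (the (PC_AB A B F f)))\<^sup>2))"

definition R_AB ::
  "('h::complex_hilbert \<Rightarrow> 'h) \<Rightarrow> (ell2 \<Rightarrow> ell2) \<Rightarrow> (nat \<Rightarrow> 'h) \<Rightarrow> ell2 seminormed_space" where
  "R_AB A B F = subspace_seminormed (ran (PC_AB A B F)) (wseminorm B)"

text \<open>The next two maps are given by their values on \<open>P\<^sub>B C\<^sub>A\<^sub>B f\<close> and on \<open>[f]\<close>; these prescriptions
  have to be checked for independence of \<open>f\<close>.\<close>

definition Phi_AB ::
  "('h::complex_hilbert \<Rightarrow> 'h) \<Rightarrow> (ell2 \<Rightarrow> ell2) \<Rightarrow> (nat \<Rightarrow> 'h) \<Rightarrow> ell2 \<Rightarrow> 'h set" where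
  "Phi_AB A B F y = (THE X. \<exists>f\<in>dom (C_AB A F). y = the (PC_AB A B F f) \<and> X = cls_AB A F f)"

definition Chat_AB ::
  "('h::complex_hilbert \<Rightarrow> 'h) \<Rightarrow> (ell2 \<Rightarrow> ell2) \<Rightarrow> (nat \<Rightarrow> 'h) \<Rightarrow> 'h set \<Rightarrow> ell2" where
  "Chat_AB A B F X = (THE y. \<exists>f\<in>dom (C_AB A F). X = cls_AB A F f \<and> y = the (PC_AB A B F f))"

end

theory Submission
  imports Defs
begin

text \<open>Since \<open>C\<^sub>A\<^sub>B f\<close> depends on \<open>A f\<close> only and \<open>B P\<^sub>B = B\<close>, one has \<open>\<parallel>P\<^sub>B C\<^sub>A\<^sub>B f\<parallel>\<^sub>B = \<parallel>C\<^sub>A\<^sub>B f\<parallel>\<^sub>B\<close>, and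
  \<open>P\<^sub>B C\<^sub>A\<^sub>B f\<close> and \<open>\<parallel>f\<parallel>\<^sub>A\<close> depend on the class \<open>[f]\<close> only. The lower semi-frame inequality therefore
  says \<open>\<parallel>[f]\<parallel>\<^sub>A \<le> \<alpha>\<^sup>-\<^sup>1\<^sup>/\<^sup>2 \<parallel>P\<^sub>B C\<^sub>A\<^sub>B f\<parallel>\<^sub>B\<close>, and it makes \<open>[f] \<mapsto> P\<^sub>B C\<^sub>A\<^sub>B f\<close> injective, because \<open>\<parallel>f\<parallel>\<^sub>A = 0\<close>
  forces \<open>A f = 0\<close> for positive \<open>A\<close>. Adding \<open>\<parallel>P\<^sub>B C\<^sub>A\<^sub>B f\<parallel>\<^sub>B\<^sup>2\<close> to both sides of the squared inequality
  gives the graph seminorm estimate.\<close>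

section \<open>Complex inner products\<close>

lemma scaleC_minus_one [simp]: "(-1) *\<^sub>C x = - (x::'a::complex_inner)"
  using scaleR_scaleC[of "-1" x] by simp

lemma scaleC_zero_left [simp]: "0 *\<^sub>C x = (0::'a::complex_inner)"
  using scaleR_scaleC[of 0 x] by simp

lemma scaleC_zero_right [simp]: "a *\<^sub>C 0 = (0::'a::complex_inner)"
  using scaleC_add_right[of a "0::'a" 0] by simp

lemma cinner_minus_left: "cinner (- x) y = - cinner x (y::'a::complex_inner)"
  using cinner_scaleC_left[of "-1" x y] by simp

lemma cinner_diff_left: "cinner (x - y) z = cinner x z - cinner y (z::'a::complex_inner)"
  using cinner_add_left[of x "- y" z] by (simp add: cinner_minus_left)

lemma cinner_add_right: "cinner x (y + z) = cinner x y + cinner x (z::'a::complex_inner)"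
  using cinner_commute[of x "y + z"] cinner_commute[of x y] cinner_commute[of x z]
  by (simp add: cinner_add_left)

lemma cinner_scaleC_right: "cinner x (a *\<^sub>C y) = cnj a * cinner x (y::'a::complex_inner)"
  using cinner_commute[of x "a *\<^sub>C y"] cinner_commute[of x y]
  by (simp add: cinner_scaleC_left)

lemma cinner_diff_right: "cinner x (y - z) = cinner x y - cinner x (z::'a::complex_inner)"
  using cinner_commute[of x "y - z"] cinner_commute[of x y] cinner_commute[of x z]
  by (simp add: cinner_diff_left)

lemma cinner_zero_left [simp]: "cinner 0 (y::'a::complex_inner) = 0"
  using cinner_scaleC_left[of 0 0 y] by simp

lemma cinner_eq_zero_iff: "cinner x x = 0 \<longleftrightarrow> x = (0::'a::complex_inner)"
  using inner_eq_Re_cinner[of x x] by auto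

lemma norm_scaleC: "norm (a *\<^sub>C x) = cmod a * norm (x::'a::complex_inner)"
proof -
  have "cinner (a *\<^sub>C x) (a *\<^sub>C x) = (a * cnj a) * cinner x x"
    by (simp add: cinner_scaleC_left cinner_scaleC_right)
  also have "a * cnj a = of_real ((cmod a)\<^sup>2)" by (rule complex_norm_square[symmetric])
  finally have "cinner (a *\<^sub>C x) (a *\<^sub>C x) = of_real ((cmod a)\<^sup>2) * cinner x x" .
  then have "(norm (a *\<^sub>C x))\<^sup>2 = (cmod a)\<^sup>2 * (norm x)\<^sup>2"
    by (simp add: power2_norm_eq_inner inner_eq_Re_cinner)
  then show ?thesis
    by (simp add: power2_eq_imp_eq power_mult_distrib)
qed

text \<open>Complex scaling is real-linear and bounded with constant \<open>cmod a\<close>, so the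
  continuity of real bounded linear maps applies to it.\<close>

lemma tendsto_scaleC:
  assumes "(f \<longlongrightarrow> (x::'a::complex_inner)) G"
  shows "((\<lambda>n. a *\<^sub>C f n) \<longlongrightarrow> a *\<^sub>C x) G"
proof -
  have "bounded_linear ((*\<^sub>C) a :: 'a \<Rightarrow> 'a)"
    by (rule bounded_linear_intro[where K = "cmod a"])
      (simp_all add: scaleC_add_right scaleR_scaleC scaleC_scaleC norm_scaleC mult.commute)
  then show ?thesis using assms by (rule bounded_linear.tendsto)
qed

section \<open>Complex subspaces and their closures\<close>

lemma csubspace_closure:
  assumes "csubspace (M :: 'a::complex_inner set)"
  shows "csubspace (closure M)"
  unfolding csubspace_def
proof (intro conjI ballI allI)
  show "0 \<in> closure M"
    using assms closure_subset by (auto simp: csubspace_def)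
next
  fix x y assume "x \<in> closure M" "y \<in> closure M"
  then obtain f g where "\<forall>n. f n \<in> M" "f \<longlonglongrightarrow> x" "\<forall>n. g n \<in> M" "g \<longlonglongrightarrow> y"
    unfolding closure_sequential by blast
  then have "\<forall>n. f n + g n \<in> M" "(\<lambda>n. f n + g n) \<longlonglongrightarrow> x + y"
    using assms by (auto simp: csubspace_def intro: tendsto_add)
  then show "x + y \<in> closure M"
    unfolding closure_sequential by (intro exI[of _ "\<lambda>n. f n + g n"] conjI)
next
  fix a x assume "x \<in> closure M"
  then obtain f where "\<forall>n. f n \<in> M" "f \<longlonglongrightarrow> x"
    unfolding closure_sequential by blast
  then have "\<forall>n. a *\<^sub>C f n \<in> M" "(\<lambda>n. a *\<^sub>C f n) \<longlonglongrightarrow> a *\<^sub>C x"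
    using assms by (auto simp: csubspace_def intro: tendsto_scaleC)
  then show "a *\<^sub>C x \<in> closure M"
    unfolding closure_sequential by (intro exI[of _ "\<lambda>n. a *\<^sub>C f n"] conjI)
qed

lemma csubspace_diff:
  assumes "csubspace M" "x \<in> M" "y \<in> M"
  shows "x - y \<in> M"
proof -
  have "(-1) *\<^sub>C y \<in> M" using assms unfolding csubspace_def by blast
  then have "x + (-1) *\<^sub>C y \<in> M" using assms unfolding csubspace_def by blast
  then show ?thesis by simp
qed

lemma csubspace_scaleR:
  assumes "csubspace M" "x \<in> M"
  shows "r *\<^sub>R x \<in> M"
  using assms unfolding csubspace_def scaleR_scaleC by blast

section \<open>Orthogonal projections\<close>

text \<open>Near t = 0 the linear term dominates, so a nonzero coefficient would make one side
  negative. This is the variational argument behind both the orthogonality of the nearest point and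
  the null vectors of a positive form.\<close>

lemma quadratic_nonneg_imp_linear_coeff_zero:
  fixes n q :: real
  assumes "\<And>t. 0 \<le> 2 * t * n + t\<^sup>2 * q"
  shows "n = 0"
proof (rule ccontr)
  assume "n \<noteq> 0"
  \<comment> \<open>Since \<open>s\<close> is positive and exceeds \<open>q\<close>, the value at t
    = -n/s, namely n^2/s * (q/s - 2), lies below -n^2/s.\<close>
  define s where "s = \<bar>q\<bar> + 1"
  have s: "s > 0" "q < s" by (auto simp: s_def)
  have "0 \<le> 2 * (- n / s) * n + (- n / s)\<^sup>2 * q" by (rule assms)
  also have "\<dots> = n\<^sup>2 / s * (q / s - 2)"
    using s by (simp add: field_simps power2_eq_square)
  also have "\<dots> < 0"
  proof (rule mult_pos_neg)
    show "n\<^sup>2 / s > 0" using s \<open>n \<noteq> 0\<close> by simp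
    have "q / s < 1" using s by simp
    then show "q / s - 2 < 0" by linarith
  qed
  finally show False by simp
qed

text \<open>A minimising sequence is Cauchy by the parallelogram law, because midpoints of its
  members stay in \<open>M\<close> and so have squared distance at least \<open>d\<close> from
  \<open>x\<close>. Completeness gives a limit and closedness keeps it in \<open>M\<close>.\<close>

lemma closed_csubspace_nearest_point:
  fixes M :: "'a::complex_hilbert set"
  assumes M: "csubspace M" and cl: "closed M"
  shows "\<exists>p\<in>M. \<forall>m\<in>M. (norm (x - p))\<^sup>2 \<le> (norm (x - m))\<^sup>2"
proof -
  define d where "d = (INF m\<in>M. (norm (x - m))\<^sup>2)"
  have ne: "M \<noteq> {}" using M by (auto simp: csubspace_def)
  have bdd: "bdd_below ((\<lambda>m. (norm (x - m))\<^sup>2) ` M)" by (rule bdd_belowI2[of _ 0]) simp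
  have le: "d \<le> (norm (x - m))\<^sup>2" if "m \<in> M" for m
    unfolding d_def using bdd that by (rule cINF_lower)
  have "\<exists>p\<in>M. (norm (x - p))\<^sup>2 < d + 1 / real (Suc n)" for n
    unfolding d_def using cINF_less_iff[OF ne bdd, of "d + 1 / real (Suc n)"]
    by (simp add: d_def)
  then obtain p where pM: "\<And>n. p n \<in> M"
    and p: "\<And>n. (norm (x - p n))\<^sup>2 < d + 1 / real (Suc n)" by metis
  have par: "(norm (p m - p n))\<^sup>2 \<le> 2 / real (Suc m) + 2 / real (Suc n)" for m n
  proof -
    let ?h = "(1/2) *\<^sub>R (p m + p n)"
    have "?h \<in> M"
      using M pM by (intro csubspace_scaleR) (auto simp: csubspace_def)
    then have "d \<le> (norm (x - ?h))\<^sup>2" by (rule le)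
    moreover have "(norm (p m - p n))\<^sup>2
        = 2 * (norm (x - p m))\<^sup>2 + 2 * (norm (x - p n))\<^sup>2 - 4 * (norm (x - ?h))\<^sup>2"
    proof -
      \<comment> \<open>The parallelogram law is applied to \<open>u\<close> and \<open>v\<close>:
        their sum is twice the vector from the midpoint to \<open>x\<close>, and their difference is
        that of the two members.\<close>
      define u v where "u = x - p m" and "v = x - p n"
      have "x - ?h = (1/2) *\<^sub>R (u + v)"
        by (simp add: u_def v_def scaleR_right_distrib scaleR_right_diff_distrib
            flip: scaleR_left_distrib)
      then have "4 * (norm (x - ?h))\<^sup>2 = (norm (u + v))\<^sup>2"
        by (simp add: power_divide)
      moreover have "p m - p n = v - u" by (simp add: u_def v_def)
      moreover have "(norm (v - u))\<^sup>2 + (norm (u + v))\<^sup>2 = 2 * (norm u)\<^sup>2 + 2 * (norm v)\<^sup>2"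
        by (simp add: power2_norm_eq_inner inner_diff_left inner_diff_right inner_add_left
            inner_add_right)
      ultimately show ?thesis by (simp add: u_def v_def)
    qed
    \<comment> \<open>The multiples of \<open>d\<close> cancel as 2 d + 2 d - 4 d, leaving only the
      two error terms.\<close>
    ultimately show ?thesis using p[of m] p[of n] by simp
  qed
  have "Cauchy p"
  proof (rule CauchyI)
    fix e :: real assume e: "0 < e"
    \<comment> \<open>Chosen so that each of the two terms of \<open>par\<close> is below e^2/2 from
      index \<open>N\<close> on.\<close>
    obtain N where N: "4 / e\<^sup>2 < real N" using reals_Archimedean2 by blast
    have "norm (p m - p n) < e" if "m \<ge> N" "n \<ge> N" for m n
    proof -
      have small: "2 / real (Suc k) < e\<^sup>2 / 2" if "k \<ge> N" for k
      proof -
        have "4 < e\<^sup>2 * real N" using N e by (simp add: field_simps)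
        also have "\<dots> \<le> e\<^sup>2 * real (Suc k)"
          using that by (intro mult_left_mono) auto
        finally show ?thesis by (simp add: field_simps)
      qed
      have "(norm (p m - p n))\<^sup>2 < e\<^sup>2"
        using par[of m n] small[OF that(1)] small[OF that(2)] by linarith
      then show ?thesis using e by (auto intro: power2_less_imp_less[of _ e])
    qed
    then show "\<exists>N. \<forall>m\<ge>N. \<forall>n\<ge>N. norm (p m - p n) < e" by blast
  qed
  then obtain l where l: "p \<longlonglongrightarrow> l"
    using Cauchy_convergent convergent_def by blast
  have "l \<in> M" using cl pM l by (rule closed_sequentially)
  moreover have "(norm (x - l))\<^sup>2 \<le> d"
  proof (rule LIMSEQ_le)
    show "(\<lambda>n. (norm (x - p n))\<^sup>2) \<longlonglongrightarrow> (norm (x - l))\<^sup>2" by (intro tendsto_intros l)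
    show "(\<lambda>n. d + 1 / real (Suc n)) \<longlonglongrightarrow> d"
      using LIMSEQ_inverse_real_of_nat_add[of d] by (simp add: inverse_eq_divide)
    show "\<exists>N. \<forall>n\<ge>N. (norm (x - p n))\<^sup>2 \<le> d + 1 / real (Suc n)"
      using p less_imp_le by blast
  qed
  ultimately show ?thesis using le order_trans by blast
qed

text \<open>Moving the nearest point along a real multiple of \<open>m\<close> gives a nonnegative
  quadratic, whose linear coefficient must vanish; this is orthogonality in real part. Two
  candidates differ by a vector of \<open>M\<close> that is orthogonal to \<open>M\<close>, hence to
  itself.\<close>

lemma closed_csubspace_projection:
  fixes M :: "'a::complex_hilbert set"
  assumes M: "csubspace M" and cl: "closed M"
  shows "\<exists>!p. p \<in> M \<and> (\<forall>m\<in>M. cinner (x - p) m = 0)"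
proof -
  obtain p where p: "p \<in> M" and min: "\<And>m. m \<in> M \<Longrightarrow> (norm (x - p))\<^sup>2 \<le> (norm (x - m))\<^sup>2"
    using closed_csubspace_nearest_point[OF M cl] by blast
  have re: "Re (cinner (x - p) m) = 0" if m: "m \<in> M" for m
  proof -
    have "0 \<le> 2 * t * inner (x - p) m + t\<^sup>2 * inner m m" for t
    proof -
      have "p - t *\<^sub>R m \<in> M"
        using M p m by (intro csubspace_diff csubspace_scaleR)
      from min[OF this] have "(norm (x - p))\<^sup>2 \<le> (norm ((x - p) + t *\<^sub>R m))\<^sup>2"
        by (simp add: algebra_simps)
      moreover have "(norm ((x - p) + t *\<^sub>R m))\<^sup>2
          = (norm (x - p))\<^sup>2 + 2 * t * inner (x - p) m + t\<^sup>2 * inner m m"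
        unfolding power2_norm_eq_inner inner_add_left inner_add_right inner_scaleR_left
          inner_scaleR_right inner_commute[of m "x - p"]
        by (simp add: power2_eq_square algebra_simps)
      ultimately show ?thesis by linarith
    qed
    then have "inner (x - p) m = 0" by (rule quadratic_nonneg_imp_linear_coeff_zero)
    then show ?thesis by (simp add: inner_eq_Re_cinner)
  qed
  have orth: "cinner (x - p) m = 0" if m: "m \<in> M" for m
  proof -
    \<comment> \<open>By conjugate linearity in the second variable, the real part at
      \<open>\<i> *\<^sub>C m\<close> is the imaginary part at \<open>m\<close>.\<close>
    have "\<i> *\<^sub>C m \<in> M" using M m by (simp add: csubspace_def)
    from re[OF this] re[OF m] show ?thesis
      by (simp add: cinner_scaleC_right complex_eq_iff)
  qed
  show ?thesis
  proof (rule ex1I[of _ p])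
    show "p \<in> M \<and> (\<forall>m\<in>M. cinner (x - p) m = 0)" using p orth by blast
    fix q assume q: "q \<in> M \<and> (\<forall>m\<in>M. cinner (x - q) m = 0)"
    then have "p - q \<in> M" using M p by (intro csubspace_diff) auto
    then have "cinner (x - q) (p - q) - cinner (x - p) (p - q) = 0" using q orth by simp
    then have "cinner (p - q) (p - q) = 0" by (simp flip: cinner_diff_left)
    then show "q = p" by (simp add: cinner_eq_zero_iff)
  qed
qed

section \<open>The projection map and its linearity\<close>

lemma orth_proj:
  fixes M :: "'a::complex_hilbert set"
  assumes "csubspace M" and "closed M"
  shows orth_proj_in: "orth_proj M x \<in> M"
    and orth_proj_orthogonal: "m \<in> M \<Longrightarrow> cinner (x - orth_proj M x) m = 0"
  using theI'[OF closed_csubspace_projection[OF assms, of x]] unfolding orth_proj_def by auto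

lemma orth_proj_eqI:
  fixes M :: "'a::complex_hilbert set"
  assumes "csubspace M" and "closed M" and "p \<in> M" and "\<And>m. m \<in> M \<Longrightarrow> cinner (x - p) m = 0"
  shows "orth_proj M x = p"
  unfolding orth_proj_def
  using assms(3,4) by (intro the1_equality[OF closed_csubspace_projection[OF assms(1,2)]]) auto

lemma orth_proj_add:
  fixes M :: "'a::complex_hilbert set"
  assumes M: "csubspace M" "closed M"
  shows "orth_proj M (x + y) = orth_proj M x + orth_proj M y"
proof (rule orth_proj_eqI[OF M])
  show "orth_proj M x + orth_proj M y \<in> M"
    using M orth_proj_in[OF M] by (simp add: csubspace_def)
  fix m assume "m \<in> M"
  then have "cinner (x - orth_proj M x) m + cinner (y - orth_proj M y) m = 0"
    using orth_proj_orthogonal[OF M] by simp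
  then show "cinner (x + y - (orth_proj M x + orth_proj M y)) m = 0"
    by (simp add: cinner_diff_left cinner_add_left algebra_simps)
qed

lemma orth_proj_scaleC:
  fixes M :: "'a::complex_hilbert set"
  assumes M: "csubspace M" "closed M"
  shows "orth_proj M (a *\<^sub>C x) = a *\<^sub>C orth_proj M x"
proof (rule orth_proj_eqI[OF M])
  show "a *\<^sub>C orth_proj M x \<in> M"
    using M orth_proj_in[OF M] by (simp add: csubspace_def)
  fix m assume "m \<in> M"
  then have "a * cinner (x - orth_proj M x) m = 0"
    using orth_proj_orthogonal[OF M] by simp
  then show "cinner (a *\<^sub>C x - a *\<^sub>C orth_proj M x) m = 0"
    by (simp add: cinner_diff_left cinner_scaleC_left algebra_simps)
qed

section \<open>Positive operators\<close>

lemma bounded_clinear_simps: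
  assumes "bounded_clinear T"
  shows "T (x + y) = T x + T y" "T (x - y) = T x - T y" "T (a *\<^sub>C x) = a *\<^sub>C T x" "T 0 = 0"
proof -
  have "linear T" using assms by (simp add: bounded_clinear_def bounded_linear.linear)
  then show "T (x + y) = T x + T y" "T (x - y) = T x - T y" "T 0 = 0"
    by (rule linear_add linear_diff linear_0)+
  show "T (a *\<^sub>C x) = a *\<^sub>C T x" using assms by (simp add: bounded_clinear_def)
qed

lemma csubspace_range:
  assumes "bounded_clinear T"
  shows "csubspace (range T)"
  unfolding csubspace_def
proof (intro conjI ballI allI)
  note T = bounded_clinear_simps[OF assms]
  show "0 \<in> range T" using T(4) by (metis rangeI)
  show "x + y \<in> range T" if "x \<in> range T" "y \<in> range T" for x y
    using that by (auto simp flip: T(1))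
  show "a *\<^sub>C x \<in> range T" if "x \<in> range T" for a x
    using that by (auto simp flip: T(3))
qed

lemma csubspace_null_space:
  assumes "bounded_clinear T"
  shows "csubspace (null_space T)"
  by (simp add: csubspace_def null_space_def bounded_clinear_simps[OF assms])

lemma positive_op_bounded_clinear: "positive_op A \<Longrightarrow> bounded_clinear A"
  by (simp add: positive_op_def)

lemma positive_op_Re_nonneg: "positive_op A \<Longrightarrow> 0 \<le> Re (cinner (A f) f)"
  by (auto simp: positive_op_def complex_nonneg_Reals_iff)

text \<open>Polarisation: the form is real at \<open>f + g\<close> and at
  \<open>f + \<i> *\<^sub>C g\<close>; the first fact yields the imaginary part of Hermitian
  symmetry, the second its real part.\<close>

lemma positive_op_selfadjoint:
  assumes "positive_op A"
  shows "cinner (A f) g = cinner f (A g)"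
proof -
  have im: "Im (cinner (A h) h) = 0" for h
    using assms by (auto simp: positive_op_def complex_nonneg_Reals_iff)
  note A = bounded_clinear_simps[OF positive_op_bounded_clinear[OF assms]]
  have "Im (cinner (A f) g) + Im (cinner (A g) f) = 0"
    using im[of "f + g"] im[of f] im[of g] by (simp add: A cinner_add_left cinner_add_right)
  moreover have "Re (cinner (A g) f) - Re (cinner (A f) g) = 0"
    using im[of "f + \<i> *\<^sub>C g"] im[of f] im[of g]
    by (simp add: A cinner_add_left cinner_add_right cinner_scaleC_left cinner_scaleC_right)
  ultimately have "cinner (A f) g = cnj (cinner (A g) f)"
    by (simp add: complex_eq_iff)
  then show ?thesis using cinner_commute[of f "A g"] by simp
qed

text \<open>Along f + t A f the form is a nonnegative quadratic in t with no constant term and with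
  linear coefficient twice the squared norm of A f.\<close>

lemma positive_op_eq_zero:
  assumes pos: "positive_op A" and "Re (cinner (A f) f) = 0"
  shows "A f = 0"
proof -
  note A = bounded_clinear_simps[OF positive_op_bounded_clinear[OF pos]]
  have "0 \<le> 2 * t * inner (A f) (A f) + t\<^sup>2 * Re (cinner (A (A f)) (A f))" for t
  proof -
    have "cinner (A (A f)) f = cinner (A f) (A f)"
      by (rule positive_op_selfadjoint[OF pos])
    then show ?thesis
      using positive_op_Re_nonneg[OF pos, of "f + complex_of_real t *\<^sub>C A f"] assms(2)
      by (simp add: A cinner_add_left cinner_add_right cinner_scaleC_left cinner_scaleC_right
          inner_eq_Re_cinner power2_eq_square algebra_simps)
  qed
  then have "inner (A f) (A f) = 0" by (rule quadratic_nonneg_imp_linear_coeff_zero)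
  then show ?thesis by simp
qed

section \<open>Weighted seminorms\<close>

lemma wseminorm_nonneg: "positive_op A \<Longrightarrow> 0 \<le> wseminorm A f"
  by (simp add: wseminorm_def positive_op_Re_nonneg)

lemma wseminorm_eq_0_iff:
  assumes "positive_op A"
  shows "wseminorm A f = 0 \<longleftrightarrow> A f = 0"
  using positive_op_eq_zero[OF assms, of f] by (auto simp: wseminorm_def)

text \<open>By self-adjointness A f is orthogonal to the null vector f - g. The seminorm thus
  descends to classes modulo the null space, and a weight \<open>B\<close> does not see the
  difference between a sequence and its projection.\<close>

lemma wseminorm_cong:
  assumes "positive_op A" and "A f = A g"
  shows "wseminorm A f = wseminorm A g"
proof -
  have "A (f - g) = 0"
    using assms by (simp add: bounded_clinear_simps positive_op_bounded_clinear)
  then have "cinner f (A (f - g)) = 0"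
    by (metis cinner_commute cinner_zero_left complex_cnj_zero)
  then have "cinner (A f) (f - g) = 0"
    by (simp add: positive_op_selfadjoint[OF assms(1)])
  then show ?thesis using assms(2) by (simp add: wseminorm_def cinner_diff_right)
qed

section \<open>The projection onto the closed range\<close>

lemma range_proj_add:
  fixes B :: "'a::complex_hilbert \<Rightarrow> 'a"
  assumes "bounded_clinear B"
  shows "range_proj B (x + y) = range_proj B x + range_proj B y"
  unfolding range_proj_def
  by (intro orth_proj_add csubspace_closure csubspace_range assms) simp

lemma range_proj_scaleC:
  fixes B :: "'a::complex_hilbert \<Rightarrow> 'a"
  assumes "bounded_clinear B"
  shows "range_proj B (a *\<^sub>C x) = a *\<^sub>C range_proj B x"
  unfolding range_proj_def
  by (intro orth_proj_scaleC csubspace_closure csubspace_range assms) simp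

text \<open>The residual v is orthogonal to the range, in particular to B (B v); self-adjointness
  turns this into the vanishing of the squared norm of B v.\<close>

lemma positive_op_range_proj:
  fixes B :: "'a::complex_hilbert \<Rightarrow> 'a"
  assumes pos: "positive_op B"
  shows "B (range_proj B x) = B x"
proof -
  note B = positive_op_bounded_clinear[OF pos]
  let ?v = "x - range_proj B x"
  have "B (B ?v) \<in> closure (range B)" by (rule subsetD[OF closure_subset rangeI])
  then have "cinner ?v (B (B ?v)) = 0"
    unfolding range_proj_def
    by (intro orth_proj_orthogonal csubspace_closure csubspace_range B) auto
  then have "cinner (B ?v) (B ?v) = 0"
    by (simp add: positive_op_selfadjoint[OF pos])
  then show ?thesis by (simp add: cinner_eq_zero_iff bounded_clinear_simps[OF B])
qed

section \<open>Seminormed spaces\<close>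

lemma topspace_seminorm_topology [simp]: "topspace (seminorm_topology X) = carrier X"
proof
  show "topspace (seminorm_topology X) \<subseteq> carrier X"
    using openin_topspace[of "seminorm_topology X"] by (simp only: openin_seminorm_topology)
  have "openin (seminorm_topology X) (carrier X)"
    unfolding openin_seminorm_topology by (auto intro: exI[of _ 1])
  then show "carrier X \<subseteq> topspace (seminorm_topology X)" by (rule openin_subset)
qed

text \<open>Linearity transfers the seminorm estimates to \<open>vdist\<close>. The upper one gives
  continuity with radius e/K, the lower one openness with radius e/L. Injectivity is asked for
  separately, because a lower estimate only shows that vectors of the kernel have seminorm
  0.\<close>

lemma top_iso_onto_rangeI:
  assumes lin: "linear_between X Y T" and inj: "inj_on T (carrier X)"
    and surj: "T ` carrier X = carrier Y"
    and add: "\<And>x y. x \<in> carrier X \<Longrightarrow> y \<in> carrier X \<Longrightarrow> vadd X x y \<in> carrier X"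
    and scale: "\<And>a x. x \<in> carrier X \<Longrightarrow> vscale X a x \<in> carrier X"
    and K: "0 < K" "\<And>x. x \<in> carrier X \<Longrightarrow> seminorm Y (T x) \<le> K * seminorm X x"
    and L: "0 < L" "\<And>x. x \<in> carrier X \<Longrightarrow> seminorm X x \<le> L * seminorm Y (T x)"
  shows "top_iso_onto_range X Y T"
proof -
  have Tdiff: "T (vadd X x (vscale X (-1) y)) = vadd Y (T x) (vscale Y (-1) (T y))"
    if "x \<in> carrier X" "y \<in> carrier X" for x y
    using lin that scale by (auto simp: linear_between_def)
  have upper: "vdist Y (T x) (T y) \<le> K * vdist X x y"
    and lower: "vdist X x y \<le> L * vdist Y (T x) (T y)"
    if "x \<in> carrier X" "y \<in> carrier X" for x y
    using K(2)[OF add[OF that(1) scale[OF that(2)]], of "-1"]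
      L(2)[OF add[OF that(1) scale[OF that(2)]], of "-1"]
    unfolding vdist_def Tdiff[OF that] by auto
  have "continuous_map (seminorm_topology X) (seminorm_topology Y) T"
    unfolding continuous_map
  proof (intro conjI allI impI)
    show "T ` topspace (seminorm_topology X) \<subseteq> topspace (seminorm_topology Y)"
      using surj by simp
    fix U assume U: "openin (seminorm_topology Y) U"
    show "openin (seminorm_topology X) {x \<in> topspace (seminorm_topology X). T x \<in> U}"
      unfolding openin_seminorm_topology
    proof (intro conjI ballI)
      fix x assume "x \<in> {x \<in> topspace (seminorm_topology X). T x \<in> U}"
      then have x: "x \<in> carrier X" "T x \<in> U" by auto
      from x(2) U obtain e where e: "e > 0" "\<And>y. y \<in> carrier Y \<Longrightarrow> vdist Y y (T x) < e \<Longrightarrow> y \<in> U"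
        unfolding openin_seminorm_topology by blast
      have "T y \<in> U" if "y \<in> carrier X" "vdist X y x < e / K" for y
      proof (rule e(2))
        show "T y \<in> carrier Y" using that surj by blast
        have "K * vdist X y x < e" using that(2) K(1) by (simp add: field_simps)
        then show "vdist Y (T y) (T x) < e" using upper[OF that(1) x(1)] by simp
      qed
      then show "\<exists>e>0. \<forall>y\<in>carrier X. vdist X y x < e
          \<longrightarrow> y \<in> {x \<in> topspace (seminorm_topology X). T x \<in> U}"
        using e(1) K(1) by (intro exI[of _ "e / K"]) simp
    qed auto
  qed
  moreover have "open_map (seminorm_topology X) (seminorm_topology Y) T"
    unfolding open_map_def
  proof (intro allI impI)
    fix U assume U: "openin (seminorm_topology X) U"
    then have UX: "U \<subseteq> carrier X" by (simp add: openin_seminorm_topology)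
    show "openin (seminorm_topology Y) (T ` U)"
      unfolding openin_seminorm_topology
    proof (intro conjI ballI)
      show "T ` U \<subseteq> carrier Y" using UX surj by blast
      fix z assume "z \<in> T ` U"
      then obtain x where x: "x \<in> U" "z = T x" by blast
      from x(1) U obtain e where e: "e > 0" "\<And>y. y \<in> carrier X \<Longrightarrow> vdist X y x < e \<Longrightarrow> y \<in> U"
        unfolding openin_seminorm_topology by blast
      have "w \<in> T ` U" if w: "w \<in> carrier Y" "vdist Y w z < e / L" for w
      proof -
        obtain y where y: "y \<in> carrier X" "w = T y" using w(1) surj by blast
        have "L * vdist Y w z < e" using w(2) L(1) by (simp add: field_simps)
        then have "vdist X y x < e" using lower[of y x] y x UX by auto
        then show ?thesis using e(2) y by blast
      qed
      then show "\<exists>e>0. \<forall>w\<in>carrier Y. vdist Y w z < e \<longrightarrow> w \<in> T ` U"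
        using e(1) L(1) by (intro exI[of _ "e / L"]) simp
    qed
  qed
  ultimately have "homeomorphic_map (seminorm_topology X) (seminorm_topology Y) T"
    using surj inj by (intro bijective_open_imp_homeomorphic_map) auto
  moreover have "subtopology (seminorm_topology Y) (T ` carrier X) = seminorm_topology Y"
    unfolding surj using subtopology_topspace[of "seminorm_topology Y"] by simp
  ultimately show ?thesis using lin by (simp add: top_iso_onto_range_def)
qed

lemma top_iso_onto_range_inj_on:
  "top_iso_onto_range X Y T \<Longrightarrow> inj_on T (carrier X)"
  using homeomorphic_imp_injective_map by (fastforce simp: top_iso_onto_range_def)

section \<open>Cosets modulo a subspace\<close>

lemma coset_eq_iff:
  assumes "csubspace (N :: 'a::complex_inner set)"
  shows "f +o N = g +o N \<longleftrightarrow> f - g \<in> N"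
proof
  assume "f +o N = g +o N"
  moreover have "f + 0 \<in> f +o N"
    using assms by (intro set_plus_intro2) (simp add: csubspace_def)
  ultimately obtain n where "n \<in> N" "f = g + n"
    by (auto simp: elt_set_plus_def)
  then show "f - g \<in> N" by simp
next
  assume fg: "f - g \<in> N"
  have "f + n \<in> g +o N" if "n \<in> N" for n
    using assms fg that set_plus_intro2[of "(f - g) + n" N g] by (simp add: csubspace_def)
  moreover have "g + n \<in> f +o N" if "n \<in> N" for n
    using set_plus_intro2[OF csubspace_diff[OF assms that fg], of f] by (simp add: algebra_simps)
  ultimately show "f +o N = g +o N" by (auto simp: elt_set_plus_def)
qed

lemma csubspace_plus_self:
  assumes "csubspace (N :: 'a::complex_inner set)"
  shows "N + N = N"
proof
  show "N + N \<subseteq> N" using assms by (auto simp: csubspace_def set_plus_def)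
  show "N \<subseteq> N + N" using assms by (metis csubspace_def set_zero_plus2)
qed

lemma coset_add:
  assumes "csubspace (N :: 'a::complex_inner set)"
  shows "(f +o N) + (g +o N) = (f + g) +o N"
  by (simp add: set_plus_rearrange csubspace_plus_self[OF assms])

lemma coset_scaleC:
  assumes N: "csubspace (N :: 'a::complex_inner set)"
  shows "(*\<^sub>C) a ` (f +o N) + N = (a *\<^sub>C f) +o N"
proof
  show "(*\<^sub>C) a ` (f +o N) + N \<subseteq> (a *\<^sub>C f) +o N"
  proof
    fix z assume "z \<in> (*\<^sub>C) a ` (f +o N) + N"
    then obtain n m where n: "n \<in> N" "m \<in> N" "z = a *\<^sub>C (f + n) + m"
      by (auto simp: set_plus_def elt_set_plus_def)
    then have "a *\<^sub>C n + m \<in> N" using N by (simp add: csubspace_def)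
    from set_plus_intro2[OF this, of "a *\<^sub>C f"] n show "z \<in> (a *\<^sub>C f) +o N"
      by (simp add: scaleC_add_right add.assoc)
  qed
  show "(a *\<^sub>C f) +o N \<subseteq> (*\<^sub>C) a ` (f +o N) + N"
  proof
    fix z assume "z \<in> (a *\<^sub>C f) +o N"
    then obtain n where n: "n \<in> N" "z = a *\<^sub>C f + n" by (auto simp: elt_set_plus_def)
    \<comment> \<open>Only the representative \<open>f\<close> itself is scaled and \<open>n\<close>
      is taken from the second summand. There is no division by \<open>a\<close>, so a = 0 is
      covered.\<close>
    have "f + 0 \<in> f +o N" using N by (intro set_plus_intro2) (simp add: csubspace_def)
    then show "z \<in> (*\<^sub>C) a ` (f +o N) + N" using n by auto
  qed
qed

text \<open>Invariance under translation by \<open>N\<close> makes the image of the coset a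
  singleton, which \<open>the_elem\<close> reads off.\<close>

lemma seminorm_quotient_seminormed:
  assumes "csubspace N" and "\<And>n. n \<in> N \<Longrightarrow> p (f + n) = p f"
  shows "seminorm (quotient_seminormed M N p) (f +o N) = p f"
proof -
  have "f + 0 \<in> f +o N"
    using assms(1) by (intro set_plus_intro2) (simp add: csubspace_def)
  then have "p ` (f +o N) = {p f}"
    using assms(2) by (force simp: elt_set_plus_def)
  then show ?thesis by (simp add: quotient_seminormed_def)
qed

section \<open>The analysis operator\<close>

lemma dom_C_AB: "dom (C_AB A F) = {f. summable (\<lambda>n. (cmod (wcinner A f (F n)))\<^sup>2)}"
  by (auto simp: C_AB_def split: if_splits)

lemma nth_C_AB: "f \<in> dom (C_AB A F) \<Longrightarrow> ell2_nth (the (C_AB A F f)) n = wcinner A f (F n)"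
  unfolding dom_C_AB by (simp add: C_AB_def ell2_nth_Abs)

lemma C_AB_add:
  assumes "bounded_clinear A" and "f \<in> dom (C_AB A F)" and "g \<in> dom (C_AB A F)"
  shows C_AB_add_dom: "f + g \<in> dom (C_AB A F)"
    and the_C_AB_add: "the (C_AB A F (f + g)) = the (C_AB A F f) + the (C_AB A F g)"
proof -
  have w: "wcinner A (f + g) (F n) = wcinner A f (F n) + wcinner A g (F n)" for n
    by (simp add: wcinner_def bounded_clinear_simps[OF assms(1)] cinner_add_left)
  show dom: "f + g \<in> dom (C_AB A F)"
    using ell2_summable_add[of "the (C_AB A F f)" "the (C_AB A F g)"]
    unfolding nth_C_AB[OF assms(2)] nth_C_AB[OF assms(3)] dom_C_AB mem_Collect_eq w .
  show "the (C_AB A F (f + g)) = the (C_AB A F f) + the (C_AB A F g)"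
    by (rule ell2_eqI) (simp add: nth_C_AB dom assms w)
qed

lemma C_AB_scaleC:
  assumes "bounded_clinear A" and "f \<in> dom (C_AB A F)"
  shows C_AB_scaleC_dom: "a *\<^sub>C f \<in> dom (C_AB A F)"
    and the_C_AB_scaleC: "the (C_AB A F (a *\<^sub>C f)) = a *\<^sub>C the (C_AB A F f)"
proof -
  have w: "wcinner A (a *\<^sub>C f) (F n) = a * wcinner A f (F n)" for n
    by (simp add: wcinner_def bounded_clinear_simps[OF assms(1)] cinner_scaleC_left)
  show dom: "a *\<^sub>C f \<in> dom (C_AB A F)"
    using ell2_summable_scale[of a "the (C_AB A F f)"]
    unfolding nth_C_AB[OF assms(2)] dom_C_AB mem_Collect_eq w .
  show "the (C_AB A F (a *\<^sub>C f)) = a *\<^sub>C the (C_AB A F f)"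
    by (rule ell2_eqI) (simp add: nth_C_AB dom assms w)
qed

lemma C_AB_null:
  assumes "A f = 0"
  shows C_AB_null_dom: "f \<in> dom (C_AB A F)" and the_C_AB_null: "the (C_AB A F f) = 0"
proof -
  show dom: "f \<in> dom (C_AB A F)" by (simp add: dom_C_AB wcinner_def assms)
  show "the (C_AB A F f) = 0"
    by (rule ell2_eqI) (simp add: nth_C_AB dom wcinner_def assms)
qed

lemma csubspace_dom_C_AB:
  assumes "bounded_clinear A"
  shows "csubspace (dom (C_AB A F))"
  unfolding csubspace_def
  using C_AB_null_dom[where A = A and f = 0] C_AB_add_dom C_AB_scaleC_dom
    bounded_clinear_simps(4)[OF assms] assms by blast

text \<open>A vector killed by \<open>A\<close> has zero coefficients, so it lies in the domain.
  Classes can therefore be handled as classes modulo the null space of \<open>A\<close>.\<close>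

lemma N_AB_eq: "N_AB A F = null_space A"
  using C_AB_null_dom by (auto simp: N_AB_def null_space_def)

section \<open>The projected analysis operator\<close>

lemma dom_PC_AB: "dom (PC_AB A B F) = dom (C_AB A F)"
  by (auto simp: PC_AB_def map_comp_def total_op_def split: option.splits)

lemma the_PC_AB: "f \<in> dom (C_AB A F) \<Longrightarrow> the (PC_AB A B F f) = range_proj B (the (C_AB A F f))"
  by (auto simp: PC_AB_def map_comp_def total_op_def split: option.splits)

declare domIff [iff del]

lemma ran_PC_AB: "ran (PC_AB A B F) = (\<lambda>f. the (PC_AB A B F f)) ` dom (C_AB A F)"
  unfolding dom_PC_AB[of A B F, symmetric] by (force simp: ran_def dom_def)

lemma wseminorm_PC_AB:
  assumes "positive_op B" and "f \<in> dom (C_AB A F)"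
  shows "wseminorm B (the (PC_AB A B F f)) = wseminorm B (the (C_AB A F f))"
  unfolding the_PC_AB[OF assms(2)]
  by (rule wseminorm_cong[OF assms(1) positive_op_range_proj[OF assms(1)]])

section \<open>The induced maps\<close>

locale weighted_sequence =
  fixes A :: "'h::complex_hilbert \<Rightarrow> 'h" and B :: "ell2 \<Rightarrow> ell2" and F :: "nat \<Rightarrow> 'h"
  assumes A: "positive_op A" and B: "positive_op B"
begin

lemmas Ac = positive_op_bounded_clinear[OF A] and Bc = positive_op_bounded_clinear[OF B]

abbreviation "D \<equiv> dom (C_AB A F)"
abbreviation "T f \<equiv> the (PC_AB A B F f)"
abbreviation "cls \<equiv> cls_AB A F"

lemma D_closed: "f \<in> D \<Longrightarrow> g \<in> D \<Longrightarrow> f + g \<in> D" "f \<in> D \<Longrightarrow> a *\<^sub>C f \<in> D"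
  using csubspace_dom_C_AB[OF Ac] by (auto simp: csubspace_def)

lemma T_add: "f \<in> D \<Longrightarrow> g \<in> D \<Longrightarrow> T (f + g) = T f + T g"
  by (simp add: the_PC_AB D_closed the_C_AB_add[OF Ac] range_proj_add[OF Bc])

lemma T_scaleC: "f \<in> D \<Longrightarrow> T (a *\<^sub>C f) = a *\<^sub>C T f"
  by (simp add: the_PC_AB D_closed the_C_AB_scaleC[OF Ac] range_proj_scaleC[OF Bc])

lemma T_null: "A f = 0 \<Longrightarrow> T f = 0"
  using range_proj_scaleC[OF Bc, of 0 0] by (simp add: the_PC_AB C_AB_null_dom the_C_AB_null)

lemma T_diff: "f \<in> D \<Longrightarrow> g \<in> D \<Longrightarrow> T (f - g) = T f - T g"
  using T_add[of f "(-1) *\<^sub>C g"] T_scaleC[of g "-1"] D_closed(2)[of g "-1"] by simp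

lemma N_csubspace: "csubspace (N_AB A F)"
  unfolding N_AB_eq by (rule csubspace_null_space[OF Ac])

text \<open>Cosets of the null space of a linear map are its fibres. Independence of the
  representative thus becomes dependence on \<open>A f\<close> alone.\<close>

lemma cls_eq_iff: "cls f = cls g \<longleftrightarrow> A f = A g"
  unfolding cls_AB_def coset_eq_iff[OF N_csubspace]
  by (simp add: N_AB_eq null_space_def bounded_clinear_simps[OF Ac])

text \<open>The difference f - g lies in the null space of \<open>A\<close>, where \<open>T\<close>
  vanishes. This makes \<open>Chat_AB\<close> and the graph seminorm well defined.\<close>

lemma T_cong: "f \<in> D \<Longrightarrow> g \<in> D \<Longrightarrow> A f = A g \<Longrightarrow> T f = T g"
  using T_null[of "f - g"] by (simp add: T_diff bounded_clinear_simps[OF Ac])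

section \<open>Operations, seminorms and induced maps on representatives\<close>

lemma Q_simps:
  "carrier (Q_AB A F) = cls ` D"
  "vadd (Q_AB A F) (cls f) (cls g) = cls (f + g)"
  "vscale (Q_AB A F) a (cls f) = cls (a *\<^sub>C f)"
  by (simp_all add: Q_AB_def quotient_seminormed_def cls_AB_def[abs_def]
      coset_add[OF N_csubspace] coset_scaleC[OF N_csubspace])

lemma Q_seminorm: "seminorm (Q_AB A F) (cls f) = wseminorm A f"
  unfolding Q_AB_def cls_AB_def
proof (rule seminorm_quotient_seminormed[OF N_csubspace])
  fix n assume "n \<in> N_AB A F"
  then show "wseminorm A (f + n) = wseminorm A f"
    by (intro wseminorm_cong[OF A]) (simp add: N_AB_eq null_space_def bounded_clinear_simps[OF Ac])
qed

lemma G_simps: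
  "carrier (G_AB A B F) = cls ` D"
  "vadd (G_AB A B F) (cls f) (cls g) = cls (f + g)"
  "vscale (G_AB A B F) a (cls f) = cls (a *\<^sub>C f)"
  by (simp_all add: G_AB_def quotient_seminormed_def cls_AB_def[abs_def]
      coset_add[OF N_csubspace] coset_scaleC[OF N_csubspace])

lemma G_seminorm:
  assumes f: "f \<in> D"
  shows "seminorm (G_AB A B F) (cls f) = sqrt ((wseminorm A f)\<^sup>2 + (wseminorm B (T f))\<^sup>2)"
  unfolding G_AB_def cls_AB_def
proof (rule seminorm_quotient_seminormed[OF N_csubspace])
  fix n assume n: "n \<in> N_AB A F"
  then have eq: "A (f + n) = A f"
    by (simp add: N_AB_eq null_space_def bounded_clinear_simps[OF Ac])
  have "f + n \<in> D" using f n by (intro D_closed) (auto simp: N_AB_def)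
  then show "sqrt ((wseminorm A (f + n))\<^sup>2 + (wseminorm B (T (f + n)))\<^sup>2)
      = sqrt ((wseminorm A f)\<^sup>2 + (wseminorm B (T f))\<^sup>2)"
    using wseminorm_cong[OF A eq] T_cong[OF _ f eq] by simp
qed

lemma R_simps:
  "carrier (R_AB A B F) = T ` D" "vadd (R_AB A B F) = (+)" "vscale (R_AB A B F) = (*\<^sub>C)"
  "seminorm (R_AB A B F) = wseminorm B"
  by (simp_all add: R_AB_def subspace_seminormed_def ran_PC_AB)

text \<open>Equal classes have equal images under \<open>A\<close>, hence under \<open>T\<close>, so
  the description has a single value.\<close>

lemma Chat: "f \<in> D \<Longrightarrow> Chat_AB A B F (cls f) = T f"
  unfolding Chat_AB_def by (rule the_equality) (auto simp: cls_eq_iff intro: T_cong)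

text \<open>The hypothesis \<open>inj\<close> is injectivity of \<open>T\<close> on classes: a point
  of the range then comes from one class only, which is what the definite description asks
  for.\<close>

lemma Phi:
  assumes inj: "\<And>f g. f \<in> D \<Longrightarrow> g \<in> D \<Longrightarrow> T f = T g \<Longrightarrow> A f = A g" and f: "f \<in> D"
  shows "Phi_AB A B F (T f) = cls f"
  unfolding Phi_AB_def
proof (rule the_equality)
  show "\<exists>g\<in>D. T f = T g \<and> cls f = cls g" using f by blast
  fix X assume "\<exists>g\<in>D. T f = T g \<and> X = cls g"
  then obtain g where "g \<in> D" "T f = T g" "X = cls g" by blast
  then show "X = cls f" using inj[of g f] f by (simp add: cls_eq_iff)
qed

text \<open>Comparing f with the vector 0 turns injectivity on classes into one inclusion; the other
  holds because \<open>T\<close> vanishes on the null space of \<open>A\<close>.\<close>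

lemma null_space_PC:
  assumes inj: "\<And>f g. f \<in> D \<Longrightarrow> g \<in> D \<Longrightarrow> T f = T g \<Longrightarrow> A f = A g"
  shows "null_space_op (PC_AB A B F) = D \<inter> null_space A"
proof -
  have "A f = 0" if "f \<in> D" "T f = 0" for f
  proof -
    have z: "A 0 = 0" by (rule bounded_clinear_simps[OF Ac])
    have "A f = A 0"
      using that C_AB_null_dom[where A = A and f = 0, OF z] T_null[OF z] by (intro inj) auto
    then show ?thesis using z by simp
  qed
  moreover have "PC_AB A B F f = Some 0 \<longleftrightarrow> T f = 0" if "f \<in> D" for f
  proof -
    obtain y where "PC_AB A B F f = Some y"
      using \<open>f \<in> D\<close> unfolding dom_PC_AB[of A B F, symmetric] by (rule domD[THEN exE])
    then show ?thesis by simp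
  qed
  ultimately show ?thesis
    using T_null by (auto simp: null_space_op_def null_space_def dom_PC_AB)
qed

section \<open>The lower semi-frame inequality and the inverse map on the range\<close>

lemma lower_semi_frame_iff:
  "0 < \<alpha> \<Longrightarrow> lower_semi_frame A B F \<alpha>
    \<longleftrightarrow> (\<forall>f\<in>D. \<alpha> * (wseminorm A f)\<^sup>2 \<le> (wseminorm B (T f))\<^sup>2)"
  by (simp add: lower_semi_frame_def wseminorm_PC_AB[OF B])

text \<open>Passes between the quadratic bound and the linear estimate for \<Phi>. Taking roots is
  reversible since \<alpha> is positive and both seminorms are nonnegative.\<close>

lemma lower_bound_iff:
  assumes "0 < \<alpha>"
  shows "\<alpha> * (wseminorm A f)\<^sup>2 \<le> (wseminorm B c)\<^sup>2
    \<longleftrightarrow> wseminorm A f \<le> \<alpha> powr (-1/2) * wseminorm B c"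
proof -
  have p: "\<alpha> powr (-1/2) = 1 / sqrt \<alpha>"
    using powr_minus[of \<alpha> "1/2"] powr_half_sqrt[of \<alpha>] assms by (simp add: inverse_eq_divide)
  have "wseminorm A f \<le> \<alpha> powr (-1/2) * wseminorm B c
      \<longleftrightarrow> sqrt \<alpha> * wseminorm A f \<le> wseminorm B c"
    unfolding p using assms by (simp add: field_simps)
  also have "\<dots> \<longleftrightarrow> (sqrt \<alpha> * wseminorm A f)\<^sup>2 \<le> (wseminorm B c)\<^sup>2"
    using assms wseminorm_nonneg[OF A] wseminorm_nonneg[OF B] by (simp add: power_mono_iff)
  finally show ?thesis using assms by (simp add: power_mult_distrib)
qed

text \<open>At f - g the right-hand side of the inequality is 0, so f - g has
  \<open>A\<close>-seminorm 0, and positivity of \<open>A\<close> puts it in the null space.\<close>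

lemma lower_semi_frame_inj:
  assumes "lower_semi_frame A B F \<alpha>" and "f \<in> D" "g \<in> D" "T f = T g"
  shows "A f = A g"
proof -
  have \<alpha>: "0 < \<alpha>" using assms(1) by (simp add: lower_semi_frame_def)
  have D: "f - g \<in> D" using assms csubspace_diff[OF csubspace_dom_C_AB[OF Ac]] by blast
  have "T (f - g) = 0" using assms by (simp add: T_diff)
  moreover have "wseminorm B 0 = 0"
    using wseminorm_eq_0_iff[OF B, of 0] bounded_clinear_simps(4)[OF Bc] by simp
  ultimately have "\<alpha> * (wseminorm A (f - g))\<^sup>2 \<le> 0"
    using assms(1) D by (force simp: lower_semi_frame_iff[OF \<alpha>])
  then have "wseminorm A (f - g) = 0"
    using \<alpha> by (simp add: mult_le_0_iff)
  then show ?thesis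
    by (simp add: wseminorm_eq_0_iff[OF A] bounded_clinear_simps[OF Ac])
qed

text \<open>Injectivity on classes makes \<open>Phi_AB\<close> the inverse of the map induced by
  \<open>T\<close>. Its linearity is inherited from \<open>T\<close>, and its bound is the
  square-root form of the inequality.\<close>

lemma lower_semi_frame_imp_Phi:
  assumes "lower_semi_frame A B F \<alpha>"
  shows "null_space_op (PC_AB A B F) = D \<inter> null_space A"
    and "\<And>f. f \<in> D \<Longrightarrow> Phi_AB A B F (T f) = cls f"
    and "bounded_between (R_AB A B F) (Q_AB A F) (Phi_AB A B F)"
    and "\<And>f. f \<in> D \<Longrightarrow> seminorm (Q_AB A F) (Phi_AB A B F (T f))
      \<le> \<alpha> powr (-1/2) * seminorm (R_AB A B F) (T f)"
proof -
  have \<alpha>: "0 < \<alpha>" using assms by (simp add: lower_semi_frame_def)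
  note inj = lower_semi_frame_inj[OF assms]
  show "null_space_op (PC_AB A B F) = D \<inter> null_space A"
    using inj by (rule null_space_PC)
  show Phi_T: "Phi_AB A B F (T f) = cls f" if "f \<in> D" for f
    using inj that by (rule Phi)
  show bound: "seminorm (Q_AB A F) (Phi_AB A B F (T f))
      \<le> \<alpha> powr (-1/2) * seminorm (R_AB A B F) (T f)" if "f \<in> D" for f
    using assms that
    unfolding Phi_T[OF that] Q_seminorm R_simps lower_semi_frame_iff[OF \<alpha>]
      lower_bound_iff[OF \<alpha>] by blast
  have "Phi_AB A B F (T f + T g) = vadd (Q_AB A F) (Phi_AB A B F (T f)) (Phi_AB A B F (T g))"
    if "f \<in> D" "g \<in> D" for f g
    using that by (simp add: Phi_T Q_simps D_closed flip: T_add)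
  moreover have "Phi_AB A B F (a *\<^sub>C T f) = vscale (Q_AB A F) a (Phi_AB A B F (T f))"
    if "f \<in> D" for a f
    using that by (simp add: Phi_T Q_simps D_closed flip: T_scaleC)
  ultimately have "linear_between (R_AB A B F) (Q_AB A F) (Phi_AB A B F)"
    by (auto simp: linear_between_def R_simps Q_simps(1) Phi_T)
  then show "bounded_between (R_AB A B F) (Q_AB A F) (Phi_AB A B F)"
    unfolding bounded_between_def R_simps(1) using bound by blast
qed

text \<open>Once \<open>Phi_AB\<close> is known to send \<open>T f\<close> to the class of f, its
  seminorm estimate is the square-root form of the inequality.\<close>

lemma lower_semi_frame_of_Phi:
  assumes "0 < \<alpha>" and "\<And>f. f \<in> D \<Longrightarrow> Phi_AB A B F (T f) = cls f"
    and "\<And>f. f \<in> D \<Longrightarrow> seminorm (Q_AB A F) (Phi_AB A B F (T f))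
      \<le> \<alpha> powr (-1/2) * seminorm (R_AB A B F) (T f)"
  shows "lower_semi_frame A B F \<alpha>"
  unfolding lower_semi_frame_iff[OF assms(1)] lower_bound_iff[OF assms(1)]
  using assms(2,3) by (simp add: Q_seminorm R_simps)

section \<open>The isomorphism for the graph seminorm\<close>

lemma the_inv_Chat:
  assumes "inj_on (Chat_AB A B F) (carrier (G_AB A B F))" and "f \<in> D"
  shows "the_inv_into (carrier (G_AB A B F)) (Chat_AB A B F) (T f) = cls f"
  using the_inv_into_f_f[OF assms(1), of "cls f"] assms(2) by (simp add: G_simps Chat)

text \<open>Subtracting the squared \<open>B\<close>-seminorm of \<open>T f\<close> from both sides
  removes the 1 in the constant; multiplying by \<alpha> gives the lower bound.\<close>

lemma graph_bound_iff:
  assumes "0 < \<alpha>" and "f \<in> D"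
  shows "(seminorm (G_AB A B F) (cls f))\<^sup>2 \<le> (1 + inverse \<alpha>) * (seminorm (R_AB A B F) (T f))\<^sup>2
    \<longleftrightarrow> \<alpha> * (wseminorm A f)\<^sup>2 \<le> (wseminorm B (T f))\<^sup>2"
  using assms by (simp add: G_seminorm R_simps field_simps)

lemma lower_semi_frame_imp_Chat:
  assumes "lower_semi_frame A B F \<alpha>"
  shows "top_iso_onto_range (G_AB A B F) (R_AB A B F) (Chat_AB A B F)"
proof -
  have \<alpha>: "0 < \<alpha>" using assms by (simp add: lower_semi_frame_def)
  show ?thesis
  \<comment> \<open>K = 1 works because the squared graph seminorm contains the squared
    \<open>B\<close>-seminorm as a summand; \<open>L\<close> is the root of the constant in the
    graph estimate.\<close>
  proof (rule top_iso_onto_rangeI[where K = 1 and L = "sqrt (1 + inverse \<alpha>)"])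
    show "linear_between (G_AB A B F) (R_AB A B F) (Chat_AB A B F)"
      by (auto simp: linear_between_def G_simps R_simps Chat D_closed T_add T_scaleC)
    show "inj_on (Chat_AB A B F) (carrier (G_AB A B F))"
      unfolding inj_on_def G_simps(1)
    proof (intro ballI impI)
      fix X Y assume "X \<in> cls ` D" "Y \<in> cls ` D" and eq: "Chat_AB A B F X = Chat_AB A B F Y"
      then obtain f g where fg: "f \<in> D" "X = cls f" "g \<in> D" "Y = cls g" by blast
      then have "T f = T g" using eq Chat by simp
      then show "X = Y" using lower_semi_frame_inj[OF assms fg(1,3)] fg by (simp add: cls_eq_iff)
    qed
    show "Chat_AB A B F ` carrier (G_AB A B F) = carrier (R_AB A B F)"
      unfolding G_simps(1) R_simps(1) image_image by (intro image_cong refl Chat)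
    show "vadd (G_AB A B F) X Y \<in> carrier (G_AB A B F)"
      if "X \<in> carrier (G_AB A B F)" "Y \<in> carrier (G_AB A B F)" for X Y
      using that by (auto simp: G_simps D_closed)
    show "vscale (G_AB A B F) a X \<in> carrier (G_AB A B F)"
      if "X \<in> carrier (G_AB A B F)" for a X
      using that by (auto simp: G_simps D_closed)
    show "0 < sqrt (1 + inverse \<alpha>)" using \<alpha> by (simp add: add_pos_pos)
    fix X assume "X \<in> carrier (G_AB A B F)"
    then obtain f where f: "f \<in> D" "X = cls f" by (auto simp: G_simps)
    show "seminorm (R_AB A B F) (Chat_AB A B F X) \<le> 1 * seminorm (G_AB A B F) X"
      using f by (auto simp: Chat R_simps G_seminorm intro!: real_le_rsqrt)
    have "(seminorm (G_AB A B F) X)\<^sup>2 \<le> (1 + inverse \<alpha>) * (seminorm (R_AB A B F) (T f))\<^sup>2"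
      using assms f by (simp add: graph_bound_iff[OF \<alpha>] lower_semi_frame_iff[OF \<alpha>])
    then have "seminorm (G_AB A B F) X \<le> sqrt ((1 + inverse \<alpha>) * (seminorm (R_AB A B F) (T f))\<^sup>2)"
      by (rule real_le_rsqrt)
    also have "\<dots> = sqrt (1 + inverse \<alpha>) * seminorm (R_AB A B F) (T f)"
      by (simp add: real_sqrt_mult R_simps wseminorm_nonneg[OF B])
    finally show "seminorm (G_AB A B F) X
        \<le> sqrt (1 + inverse \<alpha>) * seminorm (R_AB A B F) (Chat_AB A B F X)"
      using f by (simp add: Chat)
  qed simp
qed

text \<open>A homeomorphism is injective, so the inverse returns the class of f at
  \<open>T f\<close>, and the estimate becomes the one in \<open>graph_bound_iff\<close>.\<close>

lemma lower_semi_frame_iff_inv_bound: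
  assumes "0 < \<alpha>" and "top_iso_onto_range (G_AB A B F) (R_AB A B F) (Chat_AB A B F)"
  shows "lower_semi_frame A B F \<alpha> \<longleftrightarrow>
    (\<forall>f\<in>D. (seminorm (G_AB A B F)
        (the_inv_into (carrier (G_AB A B F)) (Chat_AB A B F) (T f)))\<^sup>2
      \<le> (1 + inverse \<alpha>) * (seminorm (R_AB A B F) (T f))\<^sup>2)"
  using the_inv_Chat[OF top_iso_onto_range_inj_on[OF assms(2)]]
  by (simp add: lower_semi_frame_iff[OF assms(1)] graph_bound_iff[OF assms(1)])

end

theorem theorem4p19:
  fixes A :: "'h::complex_hilbert \<Rightarrow> 'h" and B :: "ell2 \<Rightarrow> ell2"
    and F :: "nat \<Rightarrow> 'h" and \<alpha> :: real
  assumes "positive_op A" and "positive_op B"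
    and "reduced_adjoint_exists A B (C_AB A F)"
    and "reduced_adjoint_exists B A (D_AB B F)"
    and "A_adjoint_exists A (S_AB A B F)"
    and "0 < \<alpha>"
  shows "(lower_semi_frame A B F \<alpha> \<longleftrightarrow>
      null_space_op (PC_AB A B F) = dom (C_AB A F) \<inter> null_space A
      \<and> (\<forall>f\<in>dom (C_AB A F). Phi_AB A B F (the (PC_AB A B F f)) = cls_AB A F f)
      \<and> bounded_between (R_AB A B F) (Q_AB A F) (Phi_AB A B F)
      \<and> (\<forall>f\<in>dom (C_AB A F).
           seminorm (Q_AB A F) (Phi_AB A B F (the (PC_AB A B F f)))
             \<le> \<alpha> powr (-1/2) * seminorm (R_AB A B F) (the (PC_AB A B F f))))
    \<and> (lower_semi_frame A B F \<alpha> \<longleftrightarrow>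
      (\<forall>f\<in>dom (C_AB A F). Chat_AB A B F (cls_AB A F f) = the (PC_AB A B F f))
      \<and> top_iso_onto_range (G_AB A B F) (R_AB A B F) (Chat_AB A B F)
      \<and> (\<forall>f\<in>dom (C_AB A F).
           (seminorm (G_AB A B F)
              (the_inv_into (carrier (G_AB A B F)) (Chat_AB A B F) (the (PC_AB A B F f))))\<^sup>2
             \<le> (1 + inverse \<alpha>) * (seminorm (R_AB A B F) (the (PC_AB A B F f)))\<^sup>2))"
proof -
  interpret weighted_sequence A B F
    using assms(1,2) by unfold_locales
  show ?thesis
    \<comment> \<open>The first equivalence combines the two implications for \<open>Phi_AB\<close>.
      In the second, the inequality first yields the isomorphism, under which it is equivalent to
      the bound on the inverse.\<close>
    using lower_semi_frame_imp_Phi lower_semi_frame_of_Phi[OF assms(6)]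
      Chat lower_semi_frame_imp_Chat lower_semi_frame_iff_inv_bound[OF assms(6)]
    by (intro conjI iffI) blast+
qed

end
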